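(* For any pair of positive integers $a,b$, the function $$Q_{a,b}=\frac{\vartheta_a\,\vartheta_b\,\vartheta_{a+b}}{\eta}$$ is a holomorphic Jacobi form of weight $1$, index $a^2+ab+b^2$ and character $\varepsilon^8$. It is a cusp form if and only if $3\mid a'b'(a'+b')$, where $a'=a/g$, $b'=b/g$ and $g=\gcd(a,b)$.
   Context: $\eta(\tau)=q^{1/24}\prod_{n\ge1}(1-q^n)$, $\vartheta(\tau,z)=\sum_{r\in\mathbb Z}\left(\frac{-4}{r}\right)q^{r^2/8}\zeta^{r/2}$, $q=e^{2\pi i\tau}$, $\zeta=e^{2\pi iz}$, $\vartheta_a(\tau,z)=\vartheta(\tau,az)$. $\varepsilon^h$ denotes the multiplier system of $\eta^h$. For rational $k,h$ and $m\in\frac12\mathbb Z_{\ge0}$, a (weakly holomorphic) Jacobi form of weight $k$, index $m$, character $\varepsilon^h$ is, for $m\in\mathbb Z$, a function $\phi$ with $\eta^{-h}\phi$ a weakly holomorphic Jacobi form of weight $k-h/2$ and index $m$ on $SL_2(\mathbb Z)\ltimes\mathbb Z^2$ in the sense of Eichler–Zagier (and for $m\in\frac12+\mathbb Z$, one with $\eta^{-h-3}\vartheta\phi$ such a form of weight $k-1-h/2$, index $m+\frac12$); writing $\phi=\sum c(n,r)q^n\zeta^r$, it is holomorphic if $c(n,r)=0$ unless $4nm-r^2\ge0$ and a cusp form if $c(n,r)=0$ unless $4nm-r^2>0$. *)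

theory Defs
  imports "HOL-Analysis.Analysis"
begin

section \<open>Dedekind's eta function and the Jacobi theta function\<close>

definition e2pi :: "complex \<Rightarrow> complex" where
  "e2pi x = exp (2 * of_real pi * \<i> * x)"

definition eta :: "complex \<Rightarrow> complex" where
  "eta \<tau> = e2pi (\<tau> / 24) * (\<Prod>n. 1 - e2pi (of_nat (Suc n) * \<tau>))"

text \<open>
  Rational powers of \<open>\<eta>\<close>: the branch \<open>q\<^bsup>h/24\<^esup> \<Prod> (1 - q\<^sup>n)\<^sup>h\<close>, each factor being a principal power.
  Since \<open>\<bar>q\<^sup>n\<bar> < 1\<close> this is holomorphic on the upper half-plane, and for integral \<open>h\<close> it is the
  ordinary power of \<open>\<eta>\<close>.
\<close>
definition eta_power :: "rat \<Rightarrow> complex \<Rightarrow> complex" where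
  "eta_power h \<tau> = e2pi (of_rat h * \<tau> / 24)
     * (\<Prod>n. (1 - e2pi (of_nat (Suc n) * \<tau>)) powr of_rat h)"

text \<open>The Kronecker symbol \<open>(-4/r)\<close>, including negative \<open>r\<close>.\<close>
definition kronecker_minus4 :: "int \<Rightarrow> int" where
  "kronecker_minus4 r = (if r mod 4 = 1 then 1 else if r mod 4 = 3 then -1 else 0)"

definition theta :: "complex \<Rightarrow> complex \<Rightarrow> complex" where
  "theta \<tau> z = (\<Sum>\<^sub>\<infinity>r\<in>UNIV. of_int (kronecker_minus4 r)
     * e2pi (of_int (r\<^sup>2) / 8 * \<tau>) * e2pi (of_int r / 2 * z))"

definition theta_mult :: "nat \<Rightarrow> complex \<Rightarrow> complex \<Rightarrow> complex" where
  "theta_mult a \<tau> z = theta \<tau> (of_nat a * z)"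

definition theta_quotient :: "nat \<Rightarrow> nat \<Rightarrow> complex \<Rightarrow> complex \<Rightarrow> complex" where
  "theta_quotient a b \<tau> z =
     theta_mult a \<tau> z * theta_mult b \<tau> z * theta_mult (a + b) \<tau> z / eta \<tau>"

section \<open>Jacobi forms\<close>

text \<open>Joint holomorphy in \<open>(\<tau>, z)\<close>: a complex-linear Frechet derivative at every point.\<close>
definition holomorphic_on_H_C :: "(complex \<Rightarrow> complex \<Rightarrow> complex) \<Rightarrow> bool" where
  "holomorphic_on_H_C \<phi> \<longleftrightarrow> (\<forall>\<tau> z. Im \<tau> > 0 \<longrightarrow>
     (\<exists>A B. ((\<lambda>(t, w). \<phi> t w) has_derivative (\<lambda>(u, v). A * u + B * v)) (at (\<tau>, z))))"

text \<open>
  \<open>\<phi> = \<Sum> c(n,r) q\<^sup>n \<zeta>\<^sup>r\<close> with \<open>n\<close> and \<open>r\<close> running over the cosets \<open>s + \<int>\<close> and \<open>t + \<int>\<close>.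
  Values of \<open>c\<close> outside these cosets play no role.
\<close>
definition fourier_exponents :: "rat \<Rightarrow> rat \<Rightarrow> (rat \<times> rat) set" where
  "fourier_exponents s t = {(n, r). n - s \<in> \<int> \<and> r - t \<in> \<int>}"

definition has_fourier_expansion ::
  "(complex \<Rightarrow> complex \<Rightarrow> complex) \<Rightarrow> rat \<Rightarrow> rat \<Rightarrow> (rat \<Rightarrow> rat \<Rightarrow> complex) \<Rightarrow> bool" where
  "has_fourier_expansion \<phi> s t c \<longleftrightarrow> (\<forall>\<tau> z. Im \<tau> > 0 \<longrightarrow>
     ((\<lambda>(n, r). c n r * e2pi (of_rat n * \<tau>) * e2pi (of_rat r * z)) has_sum \<phi> \<tau> z)
       (fourier_exponents s t))"

text \<open>
  Weakly holomorphic Jacobi forms of integral weight and index for the full Jacobi group, with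
  trivial character, in the sense of Eichler and Zagier.
\<close>
definition weakly_holomorphic_jacobi_form_EZ ::
  "int \<Rightarrow> nat \<Rightarrow> (complex \<Rightarrow> complex \<Rightarrow> complex) \<Rightarrow> bool" where
  "weakly_holomorphic_jacobi_form_EZ k m \<phi> \<longleftrightarrow>
     holomorphic_on_H_C \<phi> \<and>
     (\<forall>a b c d :: int. \<forall>\<tau> z. a * d - b * c = 1 \<and> Im \<tau> > 0 \<longrightarrow>
        \<phi> ((of_int a * \<tau> + of_int b) / (of_int c * \<tau> + of_int d))
          (z / (of_int c * \<tau> + of_int d))
        = (of_int c * \<tau> + of_int d) powi k
          * e2pi (of_nat m * of_int c * z\<^sup>2 / (of_int c * \<tau> + of_int d)) * \<phi> \<tau> z) \<and>
     (\<forall>l \<mu> :: int. \<forall>\<tau> z. Im \<tau> > 0 \<longrightarrow>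
        \<phi> \<tau> (z + of_int l * \<tau> + of_int \<mu>)
        = e2pi (- of_nat m * ((of_int l)\<^sup>2 * \<tau> + 2 * of_int l * z)) * \<phi> \<tau> z) \<and>
     (\<exists>c. has_fourier_expansion \<phi> 0 0 c \<and>
        (\<exists>n0. \<forall>(n, r) \<in> fourier_exponents 0 0. n < n0 \<longrightarrow> c n r = 0))"

text \<open>
  Weight \<open>k\<close>, index \<open>m\<close>, character \<open>\<epsilon>\<^sup>h\<close>, where \<open>\<epsilon>\<^sup>h\<close> is the multiplier system of \<open>\<eta>\<^sup>h\<close>. The
  reduced weight \<open>k - h/2\<close> has to be an integer. For half-integral index, holomorphy of \<open>\<phi>\<close> itself
  is required since that of \<open>\<eta>\<^bsup>-h-3\<^esup> \<theta> \<phi>\<close> says nothing about the values of \<open>\<phi>\<close> at the zeros of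
  \<open>\<theta>\<close>; for integral index it follows from that of \<open>\<eta>\<^bsup>-h\<^esup> \<phi>\<close>.
\<close>
definition weakly_holomorphic_jacobi_form ::
  "rat \<Rightarrow> rat \<Rightarrow> rat \<Rightarrow> (complex \<Rightarrow> complex \<Rightarrow> complex) \<Rightarrow> bool" where
  "weakly_holomorphic_jacobi_form k m h \<phi> \<longleftrightarrow>
     (\<exists>(w :: int) (M :: nat). k - h / 2 = of_int w \<and>
        (m = of_nat M \<and>
           weakly_holomorphic_jacobi_form_EZ w M (\<lambda>\<tau> z. eta_power (- h) \<tau> * \<phi> \<tau> z)
         \<or> m = of_nat M + 1 / 2 \<and> holomorphic_on_H_C \<phi> \<and>
           weakly_holomorphic_jacobi_form_EZ (w - 1) (M + 1)
             (\<lambda>\<tau> z. eta_power (- h - 3) \<tau> * theta \<tau> z * \<phi> \<tau> z)))"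

text \<open>
  The Fourier expansion of a form of index \<open>m\<close> and character \<open>\<epsilon>\<^sup>h\<close> has \<open>n \<in> h/24 + \<int>\<close> and
  \<open>r \<in> m + \<int>\<close> (as \<open>\<eta>\<^sup>h\<close> is \<open>q\<^bsup>h/24\<^esup>\<close> times a power series in \<open>q\<close>, and \<open>\<theta>\<close> has half-integral
  exponents of \<open>\<zeta>\<close>); its coefficients are uniquely determined.
\<close>
definition holomorphic_jacobi_form ::
  "rat \<Rightarrow> rat \<Rightarrow> rat \<Rightarrow> (complex \<Rightarrow> complex \<Rightarrow> complex) \<Rightarrow> bool" where
  "holomorphic_jacobi_form k m h \<phi> \<longleftrightarrow>
     weakly_holomorphic_jacobi_form k m h \<phi> \<and>
     (\<exists>c. has_fourier_expansion \<phi> (h / 24) m c \<and>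
        (\<forall>(n, r) \<in> fourier_exponents (h / 24) m. \<not> 4 * n * m - r\<^sup>2 \<ge> 0 \<longrightarrow> c n r = 0))"

definition jacobi_cusp_form ::
  "rat \<Rightarrow> rat \<Rightarrow> rat \<Rightarrow> (complex \<Rightarrow> complex \<Rightarrow> complex) \<Rightarrow> bool" where
  "jacobi_cusp_form k m h \<phi> \<longleftrightarrow>
     weakly_holomorphic_jacobi_form k m h \<phi> \<and>
     (\<exists>c. has_fourier_expansion \<phi> (h / 24) m c \<and>
        (\<forall>(n, r) \<in> fourier_exponents (h / 24) m. \<not> 4 * n * m - r\<^sup>2 > 0 \<longrightarrow> c n r = 0))"

end

theory Submission
  imports Defs "HOL-Complex_Analysis.Complex_Analysis"
begin

text \<open>
  By the triple product identity \<open>\<theta>(\<tau>, \<cdot>)\<close> has simple zeros exactly at \<open>\<int>\<tau> + \<int>\<close>, and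
  \<open>\<theta>/\<eta>\<^sup>3\<close> has derivative \<open>2\<pi>\<i>\<close> at \<open>z = 0\<close>. For \<open>\<gamma> = (a, b; c, d)\<close> the function
  \<open>(c\<tau> + d) e(- cz\<^sup>2 / 2(c\<tau> + d)) (\<theta>/\<eta>\<^sup>3)(\<gamma>\<tau>, z/(c\<tau> + d))\<close> has the same quasi-periods, zeros
  and derivative at \<open>0\<close>, so by Liouville's theorem it equals \<open>\<theta>/\<eta>\<^sup>3\<close>. Hence \<open>\<theta>/\<eta>\<^sup>3\<close> is a
  weakly holomorphic form of weight \<open>-1\<close> and index \<open>1/2\<close>, up to signs under the lattice that
  cancel in the product of its three rescalings \<open>\<eta>\<^sup>-\<^sup>8 Q\<^sub>a\<^sub>b\<close>.

  Multiplying out the series, the terms of \<open>Q\<^sub>a\<^sub>b\<close> are indexed by odd \<open>r, s, t\<close> and \<open>l \<ge> 0\<close>, and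
  \<open>12 (4nm - R\<^sup>2) = 2m ((r + s - t)\<^sup>2 - 1) + f\<^sup>2 + 48ml\<close> for an integral linear form \<open>f\<close> in
  \<open>r, s, t\<close>. This is nonnegative because \<open>r + s - t\<close> is odd, and it vanishes for some term if and
  only if \<open>a' \<equiv> b' \<noteq> 0\<close> modulo \<open>3\<close>. Such a term is the only one with its exponent pair, so it
  does not cancel; it is detected by the limit \<open>\<tau> \<rightarrow> \<i>\<infinity>\<close> along a line \<open>z = x\<tau>\<close>.
\<close>

text \<open>The majorant \<open>M\<close> makes the finite partial sums converge uniformly in
  \<open>n\<close>, by the Weierstrass test, and uniformity allows the limit along \<open>F\<close>
  to be exchanged with the limit over finite subsets of \<open>I\<close>. It serves twice: for the
  triple product and for the limit of exponential sums.\<close>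

lemma infsum_dominated_convergence:
  fixes f :: "'a \<Rightarrow> 'b \<Rightarrow> 'c :: banach"
  assumes lim: "\<And>i. i \<in> I \<Longrightarrow> ((\<lambda>n. f n i) \<longlongrightarrow> g i) F"
    and bound: "\<forall>\<^sub>F n in F. \<forall>i\<in>I. norm (f n i) \<le> M i"
    and M: "M summable_on I"
  shows "((\<lambda>n. infsum (f n) I) \<longlongrightarrow> infsum g I) F"
proof (cases "F = bot")
  case False
  define Y where "Y = {n. \<forall>i\<in>I. norm (f n i) \<le> M i}"
  have Y: "\<forall>\<^sub>F n in F. n \<in> Y"
    using bound by (simp add: Y_def)
  have unif: "uniform_limit Y (\<lambda>X n. \<Sum>i\<in>X. f n i) (\<lambda>n. infsum (f n) I) (finite_subsets_at_top I)"
    using M by (intro Weierstrass_m_test_general[where M = M]) (auto simp: Y_def)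
  have gM: "norm (g i) \<le> M i" if i: "i \<in> I" for i
  proof (rule tendsto_upperbound)
    show "((\<lambda>n. norm (f n i)) \<longlongrightarrow> norm (g i)) F"
      by (intro tendsto_norm lim i)
    show "\<forall>\<^sub>F n in F. norm (f n i) \<le> M i"
      using bound by eventually_elim (use i in auto)
  qed fact
  have "(\<lambda>i. norm (g i)) summable_on I"
    by (rule summable_on_comparison_test[OF M gM norm_ge_zero])
  then have "g summable_on I"
    by (rule abs_summable_summable)
  then have g: "((\<lambda>X. sum g X) \<longlongrightarrow> infsum g I) (finite_subsets_at_top I)"
    by (rule infsum_tendsto)
  have "\<forall>\<^sub>F X in finite_subsets_at_top I. ((\<lambda>n. \<Sum>i\<in>X. f n i) \<longlongrightarrow> sum g X) F"
    by (rule eventually_finite_subsets_at_top_weakI) (auto intro!: tendsto_sum lim)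
  from swap_uniform_limit'[OF this g _ Y] unif
  show ?thesis by simp
qed auto

section \<open>Jacobi's triple product\<close>

text \<open>This is the symbol \<open>(q;q)_n\<close>, that is, the usual q-factorial multiplied by
  \<open>(1 - q) ^ n\<close>.\<close>

definition q_factorial :: "complex \<Rightarrow> nat \<Rightarrow> complex" where
  "q_factorial q n = (\<Prod>k<n. 1 - q ^ Suc k)"

definition euler_product :: "complex \<Rightarrow> complex" where
  "euler_product q = (\<Prod>n. 1 - q ^ Suc n)"

definition inv_q_factorial :: "complex \<Rightarrow> int \<Rightarrow> complex" where
  "inv_q_factorial q m = (if m < 0 then 0 else 1 / q_factorial q (nat m))"

lemma power_Suc_neq_1:
  fixes q :: complex
  assumes "norm q < 1"
  shows "q ^ Suc n \<noteq> 1"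
proof
  assume "q ^ Suc n = 1"
  then have "norm q ^ Suc n = 1"
    by (metis norm_one norm_power)
  moreover have "norm q ^ Suc n < 1"
    using assms by (subst power_less_one_iff) auto
  ultimately show False by simp
qed

lemma q_factorial_nonzero: "norm q < 1 \<Longrightarrow> q_factorial q n \<noteq> 0"
  using power_Suc_neq_1[of q] by (simp add: q_factorial_def del: power_Suc)

lemma inv_q_factorial_pred:
  assumes "norm q < 1" "q \<noteq> 0"
  shows "inv_q_factorial q (m - 1) = (1 - q powi m) * inv_q_factorial q m"
proof (cases "m \<le> 0")
  \<comment> \<open>At \<open>m = 0\<close> the left side vanishes by the default value and the
    right side because \<open>1 - q powi 0 = 0\<close>, so the recurrence also holds across the
    boundary.\<close>
  case True
  then show ?thesis by (auto simp: inv_q_factorial_def)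
next
  case False
  then obtain n where n: "m = int (Suc n)"
    by (metis Suc_pred int_nat_eq nat_0_le not_le_imp_less order_less_imp_le zero_less_nat_eq)
  have "q_factorial q (Suc n) = q_factorial q n * (1 - q ^ Suc n)"
    by (simp add: q_factorial_def)
  moreover have "q powi m = q ^ Suc n"
    unfolding n by (rule power_int_of_nat)
  moreover have "nat m = Suc n" "nat (m - 1) = n" "\<not> m < 0" "\<not> m - 1 < 0" using n by auto
  ultimately show ?thesis
    using q_factorial_nonzero[OF assms(1)] power_Suc_neq_1[OF assms(1), of n]
    by (simp add: inv_q_factorial_def del: power_Suc)
qed

lemma convergent_prod_one_minus_power:
  fixes q x :: complex
  assumes "norm q < 1"
  shows "convergent_prod (\<lambda>n. 1 - x * q ^ n)"
proof -
  have "summable (\<lambda>n. norm x * norm q ^ n)"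
    using assms by (intro summable_mult summable_geometric) auto
  then have "abs_convergent_prod (\<lambda>n. 1 - x * q ^ n)"
    by (intro summable_imp_abs_convergent_prod) (simp add: norm_mult norm_power)
  then show ?thesis
    by (rule abs_convergent_prod_imp_convergent_prod)
qed

lemma convergent_prod_euler:
  fixes q :: complex
  assumes "norm q < 1"
  shows "convergent_prod (\<lambda>n. 1 - q ^ Suc n)"
  using convergent_prod_one_minus_power[OF assms, of q] by simp

lemma q_factorial_LIMSEQ:
  assumes "norm q < 1"
  shows "q_factorial q \<longlonglongrightarrow> euler_product q"
proof -
  have "(\<lambda>n. \<Prod>k\<le>n. 1 - q ^ Suc k) \<longlonglongrightarrow> euler_product q"
    unfolding euler_product_def by (rule convergent_prod_LIMSEQ[OF convergent_prod_euler[OF assms]])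
  then have "(\<lambda>n. q_factorial q (Suc n)) \<longlonglongrightarrow> euler_product q"
    by (simp add: q_factorial_def lessThan_Suc_atMost)
  then show ?thesis by (rule LIMSEQ_imp_Suc)
qed

lemma euler_product_nonzero:
  assumes "norm q < 1"
  shows "euler_product q \<noteq> 0"
  unfolding euler_product_def
  by (rule prodinf_nonzero[OF convergent_prod_euler[OF assms]])
     (metis power_Suc_neq_1[OF assms] right_minus_eq)

text \<open>
  Since \<open>1/(q)\<^sub>m\<close> is taken to be \<open>0\<close> for \<open>m < 0\<close>, the recurrence \<open>inv_q_factorial_pred\<close> holds for all
  \<open>m\<close> and the sum may run over all integers, so that the induction step meets no boundary terms.
\<close>

lemma finite_triple_product:
  fixes q x :: complex
  assumes q: "norm q < 1" "q \<noteq> 0" and x: "x \<noteq> 0"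
  shows "((\<lambda>j. q_factorial q (2 * n) * inv_q_factorial q (int n - j) * inv_q_factorial q (int n + j)
            * (q powi (j * (j + 1) div 2) * (- x) powi j))
         has_sum (\<Prod>i<n. (1 - x * q ^ Suc i) * (1 - inverse x * q ^ i))) UNIV"
proof (induction n)
  case 0
  show ?case
    by (rule has_sum_finite_neutralI[of "{0}"])
       (auto simp: inv_q_factorial_def q_factorial_def split: if_splits)
next
  case (Suc n)
  define R where "R = inv_q_factorial q"
  define t where "t = (\<lambda>n j. q_factorial q (2 * n) * R (int n - j) * R (int n + j)
            * (q powi (j * (j + 1) div 2) * (- x) powi j))"
  define P where "P = (\<Prod>i<n. (1 - x * q ^ Suc i) * (1 - inverse x * q ^ i))"
  have IH: "(t n has_sum P) UNIV"
    using Suc by (simp add: t_def P_def R_def mult_ac)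
  have sh1: "((\<lambda>j. t n (j - 1)) has_sum P) UNIV"
    by (subst has_sum_reindex_bij_witness[of _ "\<lambda>j. j + 1" "\<lambda>j. j - 1" UNIV "t n" _ P P]) (use IH in auto)
  have sh2: "((\<lambda>j. t n (j + 1)) has_sum P) UNIV"
    by (subst has_sum_reindex_bij_witness[of _ "\<lambda>j. j - 1" "\<lambda>j. j + 1" UNIV "t n" _ P P]) (use IH in auto)
  \<comment> \<open>The factors with \<open>i = n\<close> multiply out to
    \<open>1 + q ^ (2 * n + 1)\<close> minus a multiple of \<open>x\<close> and a multiple of
    \<open>inverse x\<close>. Shifting \<open>j\<close> in the corresponding copies of the series
    restores the power \<open>(- x) powi j\<close> in every term.\<close>
  have "((\<lambda>j. (1 + q ^ (2 * n + 1)) * t n j + (- x * q ^ Suc n) * t n (j - 1) + (- inverse x * q ^ n) * t n (j + 1))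
     has_sum ((1 + q ^ (2 * n + 1)) * P + (- x * q ^ Suc n) * P + (- inverse x * q ^ n) * P)) UNIV"
    by (intro has_sum_add has_sum_cmult_right IH sh1 sh2)
  moreover have "(1 + q ^ (2 * n + 1)) * P + (- x * q ^ Suc n) * P + (- inverse x * q ^ n) * P
     = (\<Prod>i<Suc n. (1 - x * q ^ Suc i) * (1 - inverse x * q ^ i))"
  proof -
    have "(1 - x * q ^ Suc n) * (1 - inverse x * q ^ n)
       = 1 - x * q ^ Suc n - inverse x * q ^ n + (x * inverse x) * (q ^ n * q ^ Suc n)"
      by (simp add: algebra_simps)
    also have "(x * inverse x) * (q ^ n * q ^ Suc n) = q ^ (2 * n + 1)"
      using x by (simp add: mult_2 flip: power_add)
    finally have step: "(1 - x * q ^ Suc n) * (1 - inverse x * q ^ n)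
       = 1 - x * q ^ Suc n - inverse x * q ^ n + q ^ (2 * n + 1)" .
    show ?thesis
      unfolding prod.lessThan_Suc P_def[symmetric] step by algebra
  qed
  \<comment> \<open>Everything is expressed through \<open>a = q powi (n + 1 - j)\<close> and
    \<open>b = q powi (n + 1 + j)\<close>, whose product does not depend on \<open>j\<close>. Apart
    from the common factor \<open>f * A * B * C\<close>, a polynomial identity in \<open>a\<close>,
    \<open>b\<close> and \<open>1 / q\<close> remains.\<close>
  moreover have "(1 + q ^ (2 * n + 1)) * t n j + (- x * q ^ Suc n) * t n (j - 1)
      + (- inverse x * q ^ n) * t n (j + 1) = t (Suc n) j" for j
  proof -
    define A where "A = R (int (Suc n) - j)"
    define B where "B = R (int (Suc n) + j)"
    define a where "a = q powi (int (Suc n) - j)"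
    define b where "b = q powi (int (Suc n) + j)"
    define C where "C = q powi (j * (j + 1) div 2) * (- x) powi j"
    define f where "f = q_factorial q (2 * n)"
    note pred = inv_q_factorial_pred[OF q, folded R_def]
    have R1: "R (int n - j) = (1 - a) * A"
      using pred[of "int (Suc n) - j"] by (simp add: A_def a_def)
    have R2: "R (int n + j) = (1 - b) * B"
      using pred[of "int (Suc n) + j"] by (simp add: B_def b_def)
    have R3: "R (int n - (j + 1)) = (1 - a / q) * ((1 - a) * A)"
    proof -
      have "q powi (int n - j) = a / q"
        using q by (simp add: a_def power_int_diff power_int_add)
      moreover have "int n - (j + 1) = int n - j - 1" by simp
      ultimately show ?thesis
        using pred[of "int n - j"] R1 by (simp only:)
    qed
    have R4: "R (int n + (j - 1)) = (1 - b / q) * ((1 - b) * B)"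
    proof -
      have "q powi (int n + j) = b / q"
        using q by (simp add: b_def power_int_add)
      moreover have "int n + (j - 1) = int n + j - 1" by simp
      ultimately show ?thesis
        using pred[of "int n + j"] R2 by (simp only:)
    qed
    have R5: "R (int n - (j - 1)) = A" "R (int n + (j + 1)) = B"
      by (simp_all add: A_def B_def algebra_simps)
    have ab: "a * b = q ^ (2 * n + 2)"
    proof -
      have "a * b = q powi (int (2 * n + 2))"
        unfolding a_def b_def using q by (subst power_int_add[symmetric]) auto
      then show ?thesis by (simp only: power_int_of_nat)
    qed
    have f: "q_factorial q (2 * Suc n) = f * (1 - a * b / q) * (1 - a * b)"
      using q by (simp add: f_def q_factorial_def ab field_simps)
    have T1: "(j - 1) * (j - 1 + 1) div 2 = j * (j + 1) div 2 - j"
    proof -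
      have "(j - 1) * (j - 1 + 1) = j * (j + 1) + (- j) * 2" by (simp add: algebra_simps)
      then show ?thesis by simp
    qed
    have T2: "(j + 1) * (j + 1 + 1) div 2 = j * (j + 1) div 2 + (j + 1)"
    proof -
      have "(j + 1) * (j + 1 + 1) = j * (j + 1) + (j + 1) * 2" by (simp add: algebra_simps)
      then show ?thesis by simp
    qed
    have C1: "- x * q ^ Suc n * (q powi ((j - 1) * (j - 1 + 1) div 2) * (- x) powi (j - 1)) = a * C"
      unfolding T1 a_def C_def using q x by (simp add: power_int_diff power_int_add field_simps)
    have C2: "- inverse x * q ^ n * (q powi ((j + 1) * (j + 1 + 1) div 2) * (- x) powi (j + 1)) = b * C"
      unfolding T2 b_def C_def using q x by (simp add: power_int_diff power_int_add field_simps)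
    have "(- x * q ^ Suc n) * t n (j - 1) = f * A * ((1 - b / q) * ((1 - b) * B)) * (a * C)"
      unfolding C1[symmetric] t_def R4 R5 f_def by (simp only: mult_ac)
    moreover have "(- inverse x * q ^ n) * t n (j + 1) = f * B * ((1 - a / q) * ((1 - a) * A)) * (b * C)"
      unfolding C2[symmetric] t_def R3 R5 f_def by (simp only: mult_ac)
    moreover have "(1 + q ^ (2 * n + 1)) * t n j = (1 + a * b / q) * (f * ((1 - a) * A) * ((1 - b) * B) * C)"
      unfolding t_def R1 R2 f_def C_def ab using q by simp
    moreover have "t (Suc n) j = f * (1 - a * b / q) * (1 - a * b) * A * B * C"
      unfolding t_def f A_def B_def C_def by (simp only: mult_ac)
    moreover have "(1 + a * b / q) * (f * ((1 - a) * A) * ((1 - b) * B) * C)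
       + f * A * ((1 - b / q) * ((1 - b) * B)) * (a * C) + f * B * ((1 - a / q) * ((1 - a) * A)) * (b * C)
       = f * (1 - a * b / q) * (1 - a * b) * A * B * C"
      using q by (simp add: field_simps)
    ultimately show ?thesis by simp
  qed
  ultimately show ?case
    by (simp add: t_def R_def)
qed

section \<open>Gaussian majorants for sums over the integers\<close>

lemma exp_minus_abs_summable: "(\<lambda>r::int. exp (- \<bar>real_of_int r\<bar>)) summable_on UNIV"
proof -
  have "summable (\<lambda>n. exp (- 1 :: real) ^ n)"
    by (intro summable_geometric) auto
  then have nat: "(\<lambda>n::nat. exp (- real n)) summable_on UNIV"
    by (subst summable_on_UNIV_nonneg_real_iff) (auto simp flip: exp_of_nat_mult)
  have "(\<lambda>r::int. exp (- \<bar>real_of_int r\<bar>)) summable_on range int"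
    by (subst summable_on_reindex) (use nat in \<open>auto simp: o_def\<close>)
  moreover have "(\<lambda>r::int. exp (- \<bar>real_of_int r\<bar>)) summable_on range (\<lambda>n. - int n)"
    by (subst summable_on_reindex) (use nat in \<open>auto simp: o_def inj_on_def\<close>)
  ultimately have "(\<lambda>r::int. exp (- \<bar>real_of_int r\<bar>)) summable_on (range int \<union> range (\<lambda>n. - int n))"
    by (rule summable_on_union)
  moreover have "range int \<union> range (\<lambda>n. - int n) = UNIV"
    by (auto intro: int_cases2)
  ultimately show ?thesis by simp
qed

lemma gaussian_summable:
  fixes B \<delta> :: real
  assumes "\<delta> > 0"
  shows "(\<lambda>r::int. exp (B * \<bar>real_of_int r\<bar> - \<delta> * (real_of_int r)\<^sup>2)) summable_on UNIV"
proof (rule summable_on_comparison_test)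
  \<comment> \<open>This is the maximum of \<open>(B + 1) * y - \<delta> * y\<^sup>2\<close> over
    real \<open>y\<close>; using \<open>B + 1\<close> in place of \<open>B\<close> leaves the decay
    \<open>exp (- \<bar>r\<bar>)\<close> over.\<close>
  define C where "C = (B + 1)\<^sup>2 / (4 * \<delta>)"
  show "(\<lambda>r::int. exp C * exp (- \<bar>real_of_int r\<bar>)) summable_on UNIV"
    by (intro summable_on_cmult_right exp_minus_abs_summable)
  fix r :: int
  have "0 \<le> (2 * \<delta> * \<bar>real_of_int r\<bar> - (B + 1))\<^sup>2" by simp
  then have "(B + 1) * \<bar>real_of_int r\<bar> - \<delta> * (real_of_int r)\<^sup>2 \<le> C"
    using assms by (simp add: C_def field_simps power2_eq_square)
  then show "exp (B * \<bar>real_of_int r\<bar> - \<delta> * (real_of_int r)\<^sup>2) \<le> exp C * exp (- \<bar>real_of_int r\<bar>)"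
    by (simp add: algebra_simps flip: exp_add)
qed auto

lemma triangular_real: "real_of_int (j * (j + 1) div 2) = ((real_of_int j)\<^sup>2 + real_of_int j) / 2"
proof -
  have "even (j * (j + 1))" by simp
  then have "real_of_int (j * (j + 1) div 2) = real_of_int (j * (j + 1)) / real_of_int 2"
    by (rule real_of_int_div)
  then show ?thesis by (simp add: power2_eq_square algebra_simps)
qed

lemma power_int_conv_exp:
  fixes x :: real
  assumes "x > 0"
  shows "x powi n = exp (n * ln x)"
  using assms by (metis exp_ln exp_power_int)

lemma triple_product_summable:
  fixes q x :: complex
  assumes q: "norm q < 1" "q \<noteq> 0" and x: "x \<noteq> 0"
  shows "(\<lambda>j. norm (q powi (j * (j + 1) div 2) * (- x) powi j)) summable_on UNIV"
proof (rule summable_on_comparison_test)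
  define a where "a = - ln (norm q)"
  have a: "a > 0" using q by (simp add: a_def)
  show "(\<lambda>j::int. exp ((a / 2 + \<bar>ln (norm x)\<bar>) * \<bar>real_of_int j\<bar> - a / 2 * (real_of_int j)\<^sup>2)) summable_on UNIV"
    by (rule gaussian_summable) (use a in simp)
  fix j :: int
  have "norm (q powi (j * (j + 1) div 2) * (- x) powi j)
      = exp (- a * (((real_of_int j)\<^sup>2 + real_of_int j) / 2) + j * ln (norm x))"
    using q x by (simp add: norm_mult norm_power_int power_int_conv_exp triangular_real a_def exp_add)
  also have "\<dots> \<le> exp ((a / 2 + \<bar>ln (norm x)\<bar>) * \<bar>real_of_int j\<bar> - a / 2 * (real_of_int j)\<^sup>2)"
  proof -
    have "j * ln (norm x) \<le> \<bar>ln (norm x)\<bar> * \<bar>j\<bar>"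
      by (metis abs_ge_self abs_mult mult.commute of_int_abs)
    moreover have "a * (- j) \<le> a * \<bar>j\<bar>" using a by (intro mult_left_mono) auto
    ultimately show ?thesis by (simp add: field_simps)
  qed
  finally show "norm (q powi (j * (j + 1) div 2) * (- x) powi j)
    \<le> exp ((a / 2 + \<bar>ln (norm x)\<bar>) * \<bar>real_of_int j\<bar> - a / 2 * (real_of_int j)\<^sup>2)" .
qed auto

text \<open>Let \<open>n\<close> tend to infinity in the finite identity. The coefficients of
  \<open>g j\<close> stay bounded and tend to \<open>E * (1 / E) * (1 / E)\<close>, and
  \<open>g\<close> is absolutely summable, so the limit may be taken term by term; multiplication by
  \<open>E\<close> gives the claim.\<close>

theorem jacobi_triple_product:
  fixes q x :: complex
  assumes q: "norm q < 1" "q \<noteq> 0" and x: "x \<noteq> 0"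
  shows "((\<lambda>j. q powi (j * (j + 1) div 2) * (- x) powi j) has_sum
     euler_product q * (\<Prod>n. 1 - x * q ^ Suc n) * (\<Prod>n. 1 - inverse x * q ^ n)) UNIV"
proof -
  define E where "E = euler_product q"
  define g where "g = (\<lambda>j. q powi (j * (j + 1) div 2) * (- x) powi j)"
  define R where "R = inv_q_factorial q"
  define f where "f = (\<lambda>n j. q_factorial q (2 * n) * R (int n - j) * R (int n + j) * g j)"
  have E0: "E \<noteq> 0" using euler_product_nonzero[OF q(1)] by (simp add: E_def)
  have fac: "q_factorial q \<longlonglongrightarrow> E"
    unfolding E_def by (rule q_factorial_LIMSEQ[OF q(1)])
  have inv: "(\<lambda>n. 1 / q_factorial q n) \<longlonglongrightarrow> 1 / E"
    by (intro tendsto_divide fac tendsto_const E0)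
  obtain K1 where K1: "\<And>n. norm (q_factorial q n) \<le> K1"
    using BseqD[OF convergent_imp_Bseq[OF convergentI[OF fac]]] by blast
  obtain K2 where K2: "K2 > 0" "\<And>n. norm (1 / q_factorial q n) \<le> K2"
    using BseqD[OF convergent_imp_Bseq[OF convergentI[OF inv]]] by blast
  have K1_0: "K1 \<ge> 0" using K1[of 0] norm_ge_zero order_trans by blast
  have R: "norm (R m) \<le> K2" for m
    using K2 by (auto simp: R_def inv_q_factorial_def)
  have R_lim: "(\<lambda>n. R (h n)) \<longlonglongrightarrow> 1 / E" if h: "filterlim (\<lambda>n. nat (h n)) at_top sequentially" for h
  proof (rule Lim_transform_eventually)
    show "(\<lambda>n. 1 / q_factorial q (nat (h n))) \<longlonglongrightarrow> 1 / E"
      by (rule filterlim_compose[OF inv h])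
    \<comment> \<open>The bound 1 excludes negative \<open>h n\<close>, where \<open>R\<close> is 0
      by default whereas \<open>nat\<close> would give \<open>1 / q_factorial q 0\<close>.\<close>
    have "\<forall>\<^sub>F n in sequentially. nat (h n) \<ge> 1"
      using h by (simp add: filterlim_at_top)
    then show "\<forall>\<^sub>F n in sequentially. 1 / q_factorial q (nat (h n)) = R (h n)"
      by eventually_elim (auto simp: R_def inv_q_factorial_def)
  qed
  have R_minus: "(\<lambda>n. R (int n - j)) \<longlonglongrightarrow> 1 / E" for j
  proof (rule R_lim)
    show "filterlim (\<lambda>n. nat (int n - j)) at_top sequentially"
      unfolding filterlim_at_top
    proof
      fix Z
      show "\<forall>\<^sub>F n in sequentially. Z \<le> nat (int n - j)"
        using eventually_ge_at_top[of "nat (int Z + j)"] by eventually_elim auto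
    qed
  qed
  have R_plus: "(\<lambda>n. R (int n + j)) \<longlonglongrightarrow> 1 / E" for j
    using R_minus[of "- j"] by simp
  have dbl: "(\<lambda>n. q_factorial q (2 * n)) \<longlonglongrightarrow> E"
    by (rule filterlim_compose[OF fac]) (simp add: filterlim_subseq strict_mono_def)
  have L1: "(\<lambda>n. infsum (f n) UNIV) \<longlonglongrightarrow> infsum (\<lambda>j. E * (1 / E) * (1 / E) * g j) UNIV"
  proof (rule infsum_dominated_convergence)
    show "(\<lambda>n. f n j) \<longlonglongrightarrow> E * (1 / E) * (1 / E) * g j" for j
      unfolding f_def by (intro tendsto_mult dbl R_minus R_plus tendsto_const)
    show "\<forall>\<^sub>F n in sequentially. \<forall>j\<in>UNIV. norm (f n j) \<le> K1 * K2 * K2 * norm (g j)"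
      by (intro always_eventually allI ballI)
         (auto simp: f_def norm_mult intro!: mult_mono K1 R mult_nonneg_nonneg K1_0 less_imp_le[OF K2(1)])
    show "(\<lambda>j. K1 * K2 * K2 * norm (g j)) summable_on UNIV"
      unfolding g_def by (intro summable_on_cmult_right triple_product_summable assms)
  qed
  have L2: "infsum (f n) UNIV = (\<Prod>i<n. (1 - x * q ^ Suc i) * (1 - inverse x * q ^ i))" for n
    using finite_triple_product[OF assms, of n] unfolding f_def g_def R_def by (rule infsumI)
  have L3: "(\<lambda>n. \<Prod>i<n. (1 - x * q ^ Suc i) * (1 - inverse x * q ^ i))
      \<longlonglongrightarrow> (\<Prod>n. 1 - x * q ^ Suc n) * (\<Prod>n. 1 - inverse x * q ^ n)"
  proof -
    have lim: "(\<lambda>n. \<Prod>i<n. 1 - y * q ^ i) \<longlonglongrightarrow> (\<Prod>n. 1 - y * q ^ n)" for y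
    proof -
      have "(\<lambda>n. \<Prod>i<Suc n. 1 - y * q ^ i) \<longlonglongrightarrow> (\<Prod>n. 1 - y * q ^ n)"
        using convergent_prod_LIMSEQ[OF convergent_prod_one_minus_power[OF q(1)], of y]
        by (simp add: lessThan_Suc_atMost)
      then show ?thesis by (rule LIMSEQ_imp_Suc)
    qed
    have "(\<lambda>n. (\<Prod>i<n. 1 - x * q * q ^ i) * (\<Prod>i<n. 1 - inverse x * q ^ i))
      \<longlonglongrightarrow> (\<Prod>n. 1 - x * q * q ^ n) * (\<Prod>n. 1 - inverse x * q ^ n)"
      by (intro tendsto_mult lim)
    then show ?thesis by (simp add: prod.distrib mult_ac)
  qed
  have "infsum (\<lambda>j. E * (1 / E) * (1 / E) * g j) UNIV
      = (\<Prod>n. 1 - x * q ^ Suc n) * (\<Prod>n. 1 - inverse x * q ^ n)"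
    using L1 L3 unfolding L2 by (rule LIMSEQ_unique)
  moreover have "infsum (\<lambda>j. E * (1 / E) * (1 / E) * g j) UNIV = 1 / E * infsum g UNIV"
    using E0 infsum_cmult_right'[of "1 / E" g UNIV] by simp
  ultimately have eq: "infsum g UNIV = E * (\<Prod>n. 1 - x * q ^ Suc n) * (\<Prod>n. 1 - inverse x * q ^ n)"
    using E0 by (simp add: field_simps)
  have "g summable_on UNIV"
    using triple_product_summable[OF assms] unfolding g_def by (rule abs_summable_summable)
  then have "(g has_sum infsum g UNIV) UNIV"
    by (rule has_sum_infsum)
  then show ?thesis
    unfolding eq by (simp only: g_def E_def)
qed

section \<open>The theta function as a product\<close>

lemma e2pi_add: "e2pi (x + y) = e2pi x * e2pi y"
  by (simp add: e2pi_def exp_add ring_distribs)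

lemma e2pi_nonzero [simp]: "e2pi x \<noteq> 0"
  by (simp add: e2pi_def)

lemma e2pi_0 [simp]: "e2pi 0 = 1"
  by (simp add: e2pi_def)

lemma e2pi_minus: "e2pi (- x) = inverse (e2pi x)"
  by (simp add: e2pi_def exp_minus)

lemma e2pi_of_nat_mult: "e2pi (of_nat n * x) = e2pi x ^ n"
  by (simp add: e2pi_def exp_of_nat_mult[symmetric] mult_ac)

lemma e2pi_of_int_mult: "e2pi (of_int n * x) = e2pi x powi n"
  by (simp add: e2pi_def exp_power_int mult_ac)

lemma norm_e2pi: "norm (e2pi x) = exp (- 2 * pi * Im x)"
  by (simp add: e2pi_def)

lemma e2pi_eq_1_iff: "e2pi x = 1 \<longleftrightarrow> x \<in> \<int>"
  by (auto simp: e2pi_def exp_eq_1 complex_is_Int_iff)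

lemma e2pi_half: "e2pi (1 / 2) = - 1"
  by (simp add: e2pi_def)

lemma e2pi_of_int_half: "e2pi (of_int n / 2) = (- 1) powi n"
  using e2pi_of_int_mult[of n "1 / 2"] by (simp add: e2pi_half)

lemma has_field_derivative_e2pi [derivative_intros]:
  "(f has_field_derivative f') (at x within A) \<Longrightarrow>
    ((\<lambda>x. e2pi (f x)) has_field_derivative (2 * of_real pi * \<i> * f' * e2pi (f x))) (at x within A)"
  unfolding e2pi_def by (auto intro!: derivative_eq_intros)

lemma holomorphic_on_e2pi [holomorphic_intros]:
  "f holomorphic_on A \<Longrightarrow> (\<lambda>x. e2pi (f x)) holomorphic_on A"
  unfolding e2pi_def by (intro holomorphic_intros)

lemma continuous_on_e2pi [continuous_intros]:
  "continuous_on A f \<Longrightarrow> continuous_on A (\<lambda>x. e2pi (f x))"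
  unfolding e2pi_def by (intro continuous_intros)

lemma norm_e2pi_less_1: "Im \<tau> > 0 \<Longrightarrow> norm (e2pi \<tau>) < 1"
  by (simp add: norm_e2pi)

lemma kronecker_minus4_odd: "kronecker_minus4 (2 * j + 1) = (if even j then 1 else - 1)"
  unfolding kronecker_minus4_def by presburger

lemma kronecker_minus4_even: "even r \<Longrightarrow> kronecker_minus4 r = 0"
  unfolding kronecker_minus4_def by presburger

lemma kronecker_minus4_add: "kronecker_minus4 (r + 2 * l) = (if even l then 1 else - 1) * kronecker_minus4 r"
  unfolding kronecker_minus4_def by presburger

lemma kronecker_minus4_nonzero: "odd r \<Longrightarrow> kronecker_minus4 r \<noteq> 0"
  unfolding kronecker_minus4_def by presburger

lemma abs_kronecker_minus4_le: "\<bar>kronecker_minus4 r\<bar> \<le> 1"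
  by (simp add: kronecker_minus4_def)

lemma minus_one_powi: "(- 1 :: 'a :: division_ring) powi n = (if even n then 1 else - 1)"
  by (simp add: power_int_minus_one_minus)

section \<open>Convergence and quasi-periods of the theta series\<close>

definition theta_term :: "complex \<Rightarrow> complex \<Rightarrow> int \<Rightarrow> complex" where
  "theta_term \<tau> z r = of_int (kronecker_minus4 r)
     * e2pi (of_int (r\<^sup>2) / 8 * \<tau>) * e2pi (of_int r / 2 * z)"

text \<open>The bound depends on \<open>\<tau>\<close> and \<open>z\<close> only through
  \<open>\<delta>\<close> and \<open>B\<close>, so it can serve as a majorant on whole regions and
  not only at a point.\<close>

lemma norm_theta_term_le:
  assumes "\<delta> \<le> Im \<tau>" "\<bar>Im z\<bar> \<le> B"
  shows "norm (theta_term \<tau> z r) \<le> exp (pi * B * \<bar>real_of_int r\<bar> - pi * \<delta> / 4 * (real_of_int r)\<^sup>2)"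
proof -
  have "norm (theta_term \<tau> z r) \<le> 1 * norm (e2pi (of_int (r\<^sup>2) / 8 * \<tau>)) * norm (e2pi (of_int r / 2 * z))"
    unfolding theta_term_def norm_mult
    using abs_kronecker_minus4_le[of r] by (intro mult_right_mono) (auto simp flip: of_int_abs)
  also have "\<dots> = exp (- 2 * pi * ((real_of_int r)\<^sup>2 / 8 * Im \<tau>) - 2 * pi * (real_of_int r / 2 * Im z))"
  proof -
    have "Im (of_int (r\<^sup>2) / 8 * \<tau>) = (real_of_int r)\<^sup>2 / 8 * Im \<tau>"
      by (simp add: Im_divide flip: of_int_power)
    moreover have "Im (of_int r / 2 * z) = real_of_int r / 2 * Im z"
      by simp
    ultimately show ?thesis
      by (simp only: norm_e2pi mult_1 exp_add[symmetric]) (simp only: mult_minus_left diff_conv_add_uminus)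
  qed
  also have "\<dots> \<le> exp (pi * B * \<bar>real_of_int r\<bar> - pi * \<delta> / 4 * (real_of_int r)\<^sup>2)"
  proof -
    have "- (real_of_int r * Im z) \<le> \<bar>real_of_int r\<bar> * \<bar>Im z\<bar>"
      by (metis abs_ge_minus_self abs_mult)
    also have "\<dots> \<le> \<bar>real_of_int r\<bar> * B"
      using assms(2) by (intro mult_left_mono) auto
    finally have 1: "pi * (- (real_of_int r * Im z)) \<le> pi * (\<bar>real_of_int r\<bar> * B)"
      by (rule mult_left_mono) simp
    have "(real_of_int r)\<^sup>2 * \<delta> \<le> (real_of_int r)\<^sup>2 * Im \<tau>"
      using assms(1) by (intro mult_left_mono) auto
    then have 2: "pi * ((real_of_int r)\<^sup>2 * \<delta>) \<le> pi * ((real_of_int r)\<^sup>2 * Im \<tau>)"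
      by (rule mult_left_mono) simp
    have "- 2 * pi * ((real_of_int r)\<^sup>2 / 8 * Im \<tau>) - 2 * pi * (real_of_int r / 2 * Im z)
        = - (pi * ((real_of_int r)\<^sup>2 * Im \<tau>)) / 4 + pi * (- (real_of_int r * Im z))"
      by (simp add: field_simps)
    also have "\<dots> \<le> - (pi * ((real_of_int r)\<^sup>2 * \<delta>)) / 4 + pi * (\<bar>real_of_int r\<bar> * B)"
      using 1 2 by (intro add_mono divide_right_mono) auto
    also have "\<dots> = pi * B * \<bar>real_of_int r\<bar> - pi * \<delta> / 4 * (real_of_int r)\<^sup>2"
      by (simp add: field_simps)
    finally show ?thesis by simp
  qed
  finally show ?thesis .
qed

lemma theta_term_abs_summable:
  assumes "Im \<tau> > 0"
  shows "(\<lambda>r. norm (theta_term \<tau> z r)) summable_on UNIV"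
proof (rule summable_on_comparison_test)
  show "(\<lambda>r::int. exp (pi * \<bar>Im z\<bar> * \<bar>real_of_int r\<bar> - pi * Im \<tau> / 4 * (real_of_int r)\<^sup>2)) summable_on UNIV"
    by (rule gaussian_summable) (use assms in simp)
  show "norm (theta_term \<tau> z r)
      \<le> exp (pi * \<bar>Im z\<bar> * \<bar>real_of_int r\<bar> - pi * Im \<tau> / 4 * (real_of_int r)\<^sup>2)" for r
    by (rule norm_theta_term_le) auto
qed auto

lemma theta_has_sum:
  assumes "Im \<tau> > 0"
  shows "(theta_term \<tau> z has_sum theta \<tau> z) UNIV"
  using has_sum_infsum[OF abs_summable_summable[OF theta_term_abs_summable[OF assms]], of z]
  by (simp add: theta_def theta_term_def [abs_def])

lemma theta_has_sum_odd:
  assumes "Im \<tau> > 0"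
  shows "(theta_term \<tau> z has_sum theta \<tau> z) {r. odd r}"
proof (subst has_sum_cong_neutral)
  show "(theta_term \<tau> z has_sum theta \<tau> z) UNIV" by (rule theta_has_sum[OF assms])
qed (auto simp: theta_term_def kronecker_minus4_even)

text \<open>Completing the square, \<open>(r + 2 * l)\<^sup>2 / 8 = r\<^sup>2 / 8 + r * l / 2 +
  l\<^sup>2 / 2\<close>, so the translation by \<open>l * \<tau>\<close> amounts to replacing
  \<open>r\<close> by \<open>r + 2 * l\<close>. The sign of \<open>l\<close> comes from the
  character, that of \<open>m\<close> from \<open>r\<close> being odd.\<close>

lemma theta_quasiperiodic:
  fixes l m :: int
  assumes "Im \<tau> > 0"
  shows "theta \<tau> (z + of_int l * \<tau> + of_int m)
    = (- 1) powi (l + m) * e2pi (- ((of_int l)\<^sup>2 * \<tau> + 2 * of_int l * z) / 2) * theta \<tau> z"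
proof -
  define K where "K = (- 1) powi (l + m) * e2pi (- ((of_int l)\<^sup>2 * \<tau> + 2 * of_int l * z) / 2)"
  have "((\<lambda>r. K * theta_term \<tau> z (r + 2 * l)) has_sum K * theta \<tau> z) {r. odd r}"
  proof (rule has_sum_cmult_right)
    show "((\<lambda>r. theta_term \<tau> z (r + 2 * l)) has_sum theta \<tau> z) {r. odd r}"
      by (subst has_sum_reindex_bij_witness[of _ "\<lambda>r. r - 2 * l" "\<lambda>r. r + 2 * l" "{r. odd r}" "theta_term \<tau> z" _ _ "theta \<tau> z"])
         (use theta_has_sum_odd[OF assms] in auto)
  qed
  moreover have "K * theta_term \<tau> z (r + 2 * l) = theta_term \<tau> (z + of_int l * \<tau> + of_int m) r"
    if "odd r" for r
  proof -
    obtain j where j: "r = 2 * j + 1" using \<open>odd r\<close> by (elim oddE)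
    have "e2pi (of_int r / 2 * (z + of_int l * \<tau> + of_int m)) * e2pi (of_int (r\<^sup>2) / 8 * \<tau>)
        = e2pi (- ((of_int l)\<^sup>2 * \<tau> + 2 * of_int l * z) / 2) * e2pi (of_int ((r + 2 * l)\<^sup>2) / 8 * \<tau>)
          * e2pi (of_int (r + 2 * l) / 2 * z) * e2pi (of_int (m * r) / 2)"
      unfolding e2pi_add[symmetric]
      by (rule arg_cong[of _ _ e2pi]) (simp add: field_simps power2_eq_square)
    also have "e2pi (of_int (m * r) / 2) = (if even m then 1 else - 1)"
      unfolding e2pi_of_int_half minus_one_powi using \<open>odd r\<close> by simp
    finally show ?thesis
      unfolding theta_term_def K_def kronecker_minus4_add minus_one_powi by (simp add: mult_ac)
  qed
  ultimately have "(theta_term \<tau> (z + of_int l * \<tau> + of_int m) has_sum K * theta \<tau> z) {r. odd r}"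
    by (subst (asm) has_sum_cong) auto
  then show ?thesis
    using theta_has_sum_odd[OF assms] has_sum_unique unfolding K_def by blast
qed

text \<open>The symbol \<open>(xq;q)_\<infinity>\<close>. Starting at the first power of
  \<open>q\<close> leaves the zero of theta at \<open>z = 0\<close> to the separate factor
  \<open>e2pi (z / 2) - e2pi (- z / 2)\<close> of the product formula.\<close>

definition pochhammer_product :: "complex \<Rightarrow> complex \<Rightarrow> complex" where
  "pochhammer_product q x = (\<Prod>n. 1 - x * q ^ Suc n)"

text \<open>With \<open>r = 2 * j + 1\<close> one has
  \<open>r\<^sup>2 / 8 = 1 / 8 + j * (j + 1) / 2\<close>, so the series is the triple product at
  \<open>x = e2pi z\<close> times \<open>e2pi (\<tau> / 8) * e2pi (z / 2)\<close>. The factor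
  \<open>1 - inverse x\<close> of the last product is split off and combined with
  \<open>e2pi (z / 2)\<close>.\<close>

lemma theta_product:
  assumes "Im \<tau> > 0"
  shows "theta \<tau> z = e2pi (\<tau> / 8) * (e2pi (z / 2) - e2pi (- z / 2)) * euler_product (e2pi \<tau>)
     * pochhammer_product (e2pi \<tau>) (e2pi z) * pochhammer_product (e2pi \<tau>) (e2pi (- z))"
proof -
  define q x where "q = e2pi \<tau>" and "x = e2pi z"
  have q: "norm q < 1" "q \<noteq> 0" and x: "x \<noteq> 0"
    using norm_e2pi_less_1[OF assms] by (auto simp: q_def x_def)
  have "((\<lambda>j. theta_term \<tau> z (2 * j + 1)) has_sum theta \<tau> z) UNIV"
    by (subst has_sum_reindex_bij_witness[of _ "\<lambda>r. (r - 1) div 2" "\<lambda>j. 2 * j + 1" "{r. odd r}" "theta_term \<tau> z" _ _ "theta \<tau> z"])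
       (use theta_has_sum_odd[OF assms] in auto)
  moreover have "theta_term \<tau> z (2 * j + 1)
     = (e2pi (\<tau> / 8) * e2pi (z / 2)) * (q powi (j * (j + 1) div 2) * (- x) powi j)" for j
  proof -
    have T: "of_int (j * (j + 1) div 2) = ((of_int j)\<^sup>2 + of_int j) / (2 :: complex)"
      using arg_cong[OF triangular_real[of j], of complex_of_real] by simp
    have "e2pi (of_int ((2 * j + 1)\<^sup>2) / 8 * \<tau>) * e2pi (of_int (2 * j + 1) / 2 * z)
       = (e2pi (\<tau> / 8) * e2pi (z / 2)) * (e2pi (of_int (j * (j + 1) div 2) * \<tau>) * e2pi (of_int j * z))"
      unfolding e2pi_add[symmetric] T
      by (rule arg_cong[of _ _ e2pi]) (simp add: field_simps power2_eq_square)
    then show ?thesis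
      unfolding theta_term_def kronecker_minus4_odd q_def x_def e2pi_of_int_mult
      by (simp add: power_int_minus_left)
  qed
  moreover have "((\<lambda>j. (e2pi (\<tau> / 8) * e2pi (z / 2)) * (q powi (j * (j + 1) div 2) * (- x) powi j)) has_sum
    (e2pi (\<tau> / 8) * e2pi (z / 2)) *
     (euler_product q * (\<Prod>n. 1 - x * q ^ Suc n) * (\<Prod>n. 1 - inverse x * q ^ n))) UNIV"
    by (intro has_sum_cmult_right jacobi_triple_product q x)
  ultimately have "theta \<tau> z = (e2pi (\<tau> / 8) * e2pi (z / 2)) *
     (euler_product q * (\<Prod>n. 1 - x * q ^ Suc n) * (\<Prod>n. 1 - inverse x * q ^ n))"
    using has_sum_unique by auto
  moreover have "(\<Prod>n. 1 - inverse x * q ^ n) = (1 - inverse x) * pochhammer_product q (inverse x)"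
  proof -
    have "(\<lambda>n. 1 - inverse x * q ^ Suc n) has_prod pochhammer_product q (inverse x)"
      using convergent_prod_one_minus_power[OF q(1), of "inverse x * q"]
      unfolding pochhammer_product_def by (intro convergent_prod_has_prod) (simp add: mult_ac)
    then have "(\<lambda>n. 1 - inverse x * q ^ n) has_prod (pochhammer_product q (inverse x) * (1 - inverse x * q ^ 0))"
      by (rule has_prod_Suc_imp)
    then show ?thesis by (simp add: has_prod_iff)
  qed
  moreover have "inverse x = e2pi (- z)" by (simp add: x_def e2pi_minus)
  moreover have "e2pi (z / 2) * (1 - e2pi (- z)) = e2pi (z / 2) - e2pi (- z / 2)"
    using e2pi_add[of "z / 2" "- z"] by (simp add: algebra_simps)
  ultimately show ?thesis
    unfolding pochhammer_product_def q_def x_def by (simp add: mult_ac)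
qed

section \<open>Holomorphy and zeros of the infinite products\<close>

lemma holomorphic_on_prodinf:
  fixes f :: "nat \<Rightarrow> complex \<Rightarrow> complex"
  assumes S: "open S" and f: "\<And>n. f n holomorphic_on S"
    and bound: "\<And>K. compact K \<Longrightarrow> K \<subseteq> S \<Longrightarrow> \<exists>M. summable M \<and> (\<forall>n. \<forall>z\<in>K. norm (f n z - 1) \<le> M n)"
  shows "(\<lambda>z. \<Prod>n. f n z) holomorphic_on S"
  unfolding holomorphic_on_def
proof
  fix z assume "z \<in> S"
  then obtain r where r: "r > 0" "cball z r \<subseteq> S"
    using S open_contains_cball by blast
  obtain M where M: "summable M" "\<And>n w. w \<in> cball z r \<Longrightarrow> norm (f n w - 1) \<le> M n"
    using bound[of "cball z r"] r by auto
  have cont: "continuous_on (cball z r) (f n)" for n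
    using f r by (meson holomorphic_on_imp_continuous_on holomorphic_on_subset)
  \<comment> \<open>The majorant turns convergence of the partial products into uniform convergence
    on the closed disc, which passes holomorphy on to the limit in the interior.\<close>
  have "uniformly_convergent_on (cball z r) (\<lambda>N w. \<Prod>n<N. f n w)"
  proof (rule uniformly_convergent_on_prod'[OF cont])
    show "uniformly_convergent_on (cball z r) (\<lambda>N w. \<Sum>n<N. norm (f n w - 1))"
      by (rule Weierstrass_m_test'[OF _ M(1)]) (use M(2) in auto)
  qed auto
  then obtain g where g: "uniform_limit (cball z r) (\<lambda>N w. \<Prod>n<N. f n w) g sequentially"
    by (auto simp: uniformly_convergent_on_def)
  have g_eq: "(\<Prod>n. f n w) = g w" if w: "w \<in> cball z r" for w
  proof -
    have "summable (\<lambda>n. norm (f n w - 1))"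
      by (rule summable_comparison_test'[OF M(1)]) (use M(2)[OF w] in auto)
    then have "convergent_prod (\<lambda>n. f n w)"
      by (rule abs_convergent_prod_imp_convergent_prod[OF summable_imp_abs_convergent_prod])
    then have "(\<lambda>n. \<Prod>k\<le>n. f k w) \<longlonglongrightarrow> (\<Prod>n. f n w)"
      by (rule convergent_prod_LIMSEQ)
    then have "(\<lambda>n. \<Prod>k<n. f k w) \<longlonglongrightarrow> (\<Prod>n. f n w)"
      by (simp add: LIMSEQ_lessThan_iff_atMost)
    from LIMSEQ_unique[OF this tendsto_uniform_limitI[OF g w]]
    show ?thesis .
  qed
  obtain "continuous_on (cball z r) g" and hol: "g holomorphic_on ball z r"
  proof (rule holomorphic_uniform_limit[OF _ g])
    show "\<forall>\<^sub>F N in sequentially. continuous_on (cball z r) (\<lambda>w. \<Prod>n<N. f n w)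
        \<and> (\<lambda>w. \<Prod>n<N. f n w) holomorphic_on ball z r"
      using cont holomorphic_on_subset[OF f subset_trans[OF ball_subset_cball r(2)]]
      by (intro always_eventually allI conjI continuous_on_prod holomorphic_on_prod) auto
  qed auto
  have "(\<lambda>w. \<Prod>n. f n w) holomorphic_on ball z r"
    using hol by (rule holomorphic_transform) (use g_eq in auto)
  then have "(\<lambda>w. \<Prod>n. f n w) field_differentiable at z"
    using r by (simp add: holomorphic_on_imp_differentiable_at)
  then show "(\<lambda>w. \<Prod>n. f n w) field_differentiable at z within S"
    by (rule field_differentiable_at_within)
qed

lemma holomorphic_pochhammer_product:
  assumes q: "norm q < 1"
  shows "pochhammer_product q holomorphic_on UNIV"
  unfolding pochhammer_product_def
proof (rule holomorphic_on_prodinf)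
  fix K :: "complex set" assume "compact K"
  then obtain B where B: "\<And>z. z \<in> K \<Longrightarrow> norm z \<le> B"
    using compact_imp_bounded bounded_iff by metis
  show "\<exists>M. summable M \<and> (\<forall>n. \<forall>z\<in>K. norm (1 - z * q ^ Suc n - 1) \<le> M n)"
  proof (intro exI[of _ "\<lambda>n. B * (norm q * norm q ^ n)"] conjI allI ballI)
    show "summable (\<lambda>n. B * (norm q * norm q ^ n))"
      using q by (intro summable_mult summable_geometric) auto
    fix n z assume "z \<in> K"
    then show "norm (1 - z * q ^ Suc n - 1) \<le> B * (norm q * norm q ^ n)"
      using B[of z] by (auto simp: norm_mult norm_power intro!: mult_right_mono)
  qed
qed (auto intro!: holomorphic_intros)

lemma holomorphic_euler_product: "euler_product holomorphic_on ball 0 1"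
  unfolding euler_product_def
proof (rule holomorphic_on_prodinf)
  fix K :: "complex set" assume K: "compact K" "K \<subseteq> ball 0 1"
  obtain \<rho> where \<rho>: "0 \<le> \<rho>" "\<rho> < 1" "\<And>z. z \<in> K \<Longrightarrow> norm z \<le> \<rho>"
  proof (cases "K = {}")
    case False
    obtain w where "w \<in> K" "\<And>z. z \<in> K \<Longrightarrow> norm z \<le> norm w"
      using continuous_attains_sup[OF K(1) False continuous_on_norm_id] by blast
    then show ?thesis using K by (intro that[of "norm w"]) auto
  qed (use that[of 0] in auto)
  show "\<exists>M. summable M \<and> (\<forall>n. \<forall>z\<in>K. norm (1 - z ^ Suc n - 1) \<le> M n)"
  proof (intro exI[of _ "\<lambda>n. \<rho> * \<rho> ^ n"] conjI allI ballI)
    show "summable (\<lambda>n. \<rho> * \<rho> ^ n)"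
      using \<rho> by (intro summable_mult summable_geometric) auto
    fix n z assume "z \<in> K"
    then have "norm z ^ Suc n \<le> \<rho> ^ Suc n"
      using \<rho> by (intro power_mono) auto
    then show "norm (1 - z ^ Suc n - 1) \<le> \<rho> * \<rho> ^ n"
      by (simp add: norm_mult norm_power)
  qed
qed (auto intro!: holomorphic_intros)

lemma pochhammer_product_1: "pochhammer_product q 1 = euler_product q"
  by (simp add: pochhammer_product_def euler_product_def)

lemma euler_product_0: "euler_product 0 = 1"
  by (simp add: euler_product_def)

lemma eta_conv_euler_product: "eta \<tau> = e2pi (\<tau> / 24) * euler_product (e2pi \<tau>)"
  by (simp add: eta_def euler_product_def e2pi_of_nat_mult[of "Suc _"] del: of_nat_Suc power_Suc)

lemma eta_nonzero: "Im \<tau> > 0 \<Longrightarrow> eta \<tau> \<noteq> 0"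
  by (simp add: eta_conv_euler_product euler_product_nonzero norm_e2pi_less_1)

lemma pochhammer_product_eq_0D:
  assumes "norm q < 1" "pochhammer_product q x = 0"
  shows "\<exists>n. x * q ^ Suc n = 1"
proof (rule ccontr)
  assume *: "\<not> ?thesis"
  have "convergent_prod (\<lambda>n. 1 - x * q ^ Suc n)"
    using convergent_prod_one_minus_power[OF assms(1), of "x * q"] by (simp add: mult_ac)
  from prodinf_nonzero[OF this] * assms(2) show False
    unfolding pochhammer_product_def by (metis right_minus_eq)
qed

text \<open>One factor of the product formula must vanish. The first gives
  \<open>e2pi z = 1\<close>, the other two give
  \<open>e2pi (s * z) * e2pi \<tau> ^ Suc n = 1\<close> with \<open>s = 1\<close> or
  \<open>s = - 1\<close>; in each case an integer combination of \<open>z\<close> and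
  \<open>\<tau>\<close> is an integer.\<close>

lemma theta_eq_0D:
  assumes "Im \<tau> > 0" "theta \<tau> z = 0"
  shows "\<exists>l m :: int. z = of_int l * \<tau> + of_int m"
proof -
  note q = norm_e2pi_less_1[OF assms(1)]
  have lattice: "\<exists>l m :: int. z = of_int l * \<tau> + of_int m"
    if zero: "pochhammer_product (e2pi \<tau>) (e2pi (of_int s * z)) = 0" and s: "s = 1 \<or> s = - 1" for s :: int
  proof -
    obtain n where "e2pi (of_int s * z) * e2pi \<tau> ^ Suc n = 1"
      using pochhammer_product_eq_0D[OF q zero] by blast
    then have "e2pi (of_int s * z + of_nat (Suc n) * \<tau>) = 1"
      by (simp only: e2pi_add e2pi_of_nat_mult)
    then obtain k where k: "of_int s * z + of_nat (Suc n) * \<tau> = of_int k"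
      by (auto simp: e2pi_eq_1_iff elim: Ints_cases)
    then have "z = of_int (- s * int (Suc n)) * \<tau> + of_int (s * k)"
      using s by (auto simp: algebra_simps)
    then show ?thesis by blast
  qed
  consider "e2pi (z / 2) = e2pi (- z / 2)" | "pochhammer_product (e2pi \<tau>) (e2pi z) = 0"
    | "pochhammer_product (e2pi \<tau>) (e2pi (- z)) = 0"
    using assms euler_product_nonzero[OF q] by (auto simp: theta_product)
  then show ?thesis
  proof cases
    case 1
    have "e2pi z = e2pi (z / 2) * e2pi (z / 2)"
      by (simp flip: e2pi_add)
    also have "\<dots> = e2pi (- z / 2) * e2pi (z / 2)" using 1 by simp
    also have "\<dots> = 1" by (simp flip: e2pi_add)
    finally obtain m where "z = of_int m"
      by (auto simp: e2pi_eq_1_iff elim: Ints_cases)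
    then show ?thesis by (intro exI[of _ 0] exI[of _ m]) simp
  qed (use lattice[of 1] lattice[of "-1"] in auto)
qed

lemma theta_holomorphic:
  assumes "Im \<tau> > 0"
  shows "theta \<tau> holomorphic_on UNIV"
proof -
  note P = holomorphic_pochhammer_product[OF norm_e2pi_less_1[OF assms]]
  have "(\<lambda>z. e2pi (\<tau> / 8) * (e2pi (z / 2) - e2pi (- z / 2)) * euler_product (e2pi \<tau>)
     * (pochhammer_product (e2pi \<tau>) \<circ> e2pi) z
     * (pochhammer_product (e2pi \<tau>) \<circ> (\<lambda>z. e2pi (- z))) z) holomorphic_on UNIV"
    by (intro holomorphic_intros holomorphic_on_compose[THEN holomorphic_on_subset]
        holomorphic_on_subset[OF P]) auto
  then show ?thesis
    by (rule holomorphic_transform) (simp add: theta_product[OF assms])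
qed

text \<open>The normalisation by \<open>\<eta>\<^sup>3\<close> makes the derivative at \<open>z = 0\<close> independent of \<open>\<tau>\<close>.\<close>

definition theta_eta :: "complex \<Rightarrow> complex \<Rightarrow> complex" where
  "theta_eta \<tau> z = theta \<tau> z / eta \<tau> ^ 3"

lemma theta_eta_holomorphic: "Im \<tau> > 0 \<Longrightarrow> theta_eta \<tau> holomorphic_on UNIV"
  unfolding theta_eta_def by (intro holomorphic_intros theta_holomorphic) (auto simp: eta_nonzero)

lemma theta_eta_0: "Im \<tau> > 0 \<Longrightarrow> theta_eta \<tau> 0 = 0"
  by (simp add: theta_eta_def theta_product)

text \<open>Split off \<open>e2pi (z / 2) - e2pi (- z / 2)\<close>, which vanishes at 0 with
  derivative \<open>2 * pi * \<i>\<close>. The cofactor \<open>C\<close> is 1 at 0, since both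
  Pochhammer products become Euler products there and cancel against the cube of eta.\<close>

lemma theta_eta_deriv_0:
  assumes "Im \<tau> > 0"
  shows "(theta_eta \<tau> has_field_derivative 2 * of_real pi * \<i>) (at 0)"
proof -
  define q where "q = e2pi \<tau>"
  have q: "norm q < 1" using norm_e2pi_less_1[OF assms] by (simp add: q_def)
  define C where "C = (\<lambda>z. e2pi (\<tau> / 8) * euler_product q
     * pochhammer_product q (e2pi z) * pochhammer_product q (e2pi (- z)) / eta \<tau> ^ 3)"
  have C0: "C 0 = 1"
  proof -
    have "eta \<tau> ^ 3 = e2pi (\<tau> / 8) * euler_product q ^ 3"
      using e2pi_of_nat_mult[of 3 "\<tau> / 24"]
      by (simp add: eta_conv_euler_product power_mult_distrib q_def)
    then show ?thesis
      using euler_product_nonzero[OF q] by (simp add: C_def pochhammer_product_1 power3_eq_cube)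
  qed
  have "C holomorphic_on UNIV"
  proof -
    have "(\<lambda>z. e2pi (\<tau> / 8) * euler_product q * (pochhammer_product q \<circ> e2pi) z
     * (pochhammer_product q \<circ> (\<lambda>z. e2pi (- z))) z / eta \<tau> ^ 3) holomorphic_on UNIV"
      by (intro holomorphic_intros holomorphic_on_compose[THEN holomorphic_on_subset]
          holomorphic_on_subset[OF holomorphic_pochhammer_product[OF q]]) (auto simp: eta_nonzero assms)
    then show ?thesis by (simp add: C_def)
  qed
  then obtain C' where C': "(C has_field_derivative C') (at 0)"
    using holomorphic_on_imp_differentiable_at[of C UNIV 0] by (auto simp: field_differentiable_def)
  have "((\<lambda>z. (e2pi (z / 2) - e2pi (- z / 2)) * C z) has_field_derivative
     (2 * of_real pi * \<i>) * C 0) (at 0)"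
    by (rule derivative_eq_intros C' refl | simp)+
  moreover have "theta_eta \<tau> = (\<lambda>z. (e2pi (z / 2) - e2pi (- z / 2)) * C z)"
    using assms by (simp add: fun_eq_iff theta_eta_def theta_product C_def q_def)
  ultimately show ?thesis using C0 by simp
qed

section \<open>Modular transformation\<close>

lemma complex_eq_real_combination:
  fixes \<tau> z :: complex
  assumes "Im \<tau> > 0"
  obtains x y :: real where "z = of_real x * \<tau> + of_real y"
proof
  show "z = of_real (Im z / Im \<tau>) * \<tau> + of_real (Re z - Im z / Im \<tau> * Re \<tau>)"
    using assms by (simp add: complex_eq_iff)
qed

text \<open>All values are already attained on the compact fundamental parallelogram, so the
  function is bounded and Liouville's theorem applies.\<close>

lemma doubly_periodic_entire_constant:
  fixes K :: "complex \<Rightarrow> complex"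
  assumes \<tau>: "Im \<tau> > 0" and K: "K holomorphic_on UNIV"
    and periodic: "\<And>l m :: int. \<And>z. K (z + of_int l * \<tau> + of_int m) = K z"
  shows "K z = K 0"
proof -
  define P where "P = (\<lambda>(x, y). of_real x * \<tau> + of_real y) ` ({0..1::real} \<times> {0..1::real})"
  have "compact P"
    unfolding P_def case_prod_unfold
    by (intro compact_continuous_image compact_Times compact_Icc continuous_intros)
  then have "compact (K ` P)"
    using K by (meson compact_continuous_image holomorphic_on_imp_continuous_on holomorphic_on_subset subset_UNIV)
  moreover have "range K \<subseteq> K ` P"
  proof safe
    fix z
    obtain x y :: real where z: "z = of_real x * \<tau> + of_real y"
      using complex_eq_real_combination[OF \<tau>] .
    define w where "w = of_real (x - of_int \<lfloor>x\<rfloor>) * \<tau> + of_real (y - of_int \<lfloor>y\<rfloor>)"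
    have "w \<in> P"
      unfolding P_def w_def by (rule image_eqI[of _ _ "(frac x, frac y)"]) (auto simp: frac_def less_imp_le[OF frac_lt_1, unfolded frac_def])
    moreover have "K z = K w"
    proof -
      have "w + of_int \<lfloor>x\<rfloor> * \<tau> + of_int \<lfloor>y\<rfloor> = z"
        by (simp add: w_def z algebra_simps)
      then show ?thesis using periodic by metis
    qed
    ultimately show "K z \<in> K ` P" by blast
  qed
  ultimately have "bounded (range K)"
    using compact_imp_bounded bounded_subset by blast
  then have "K constant_on UNIV"
    by (rule Liouville_theorem[OF K])
  then show ?thesis by (metis UNIV_I constant_on_def)
qed

text \<open>The quotient of \<open>h\<close> by \<open>g\<close> is doubly periodic because the
  factors \<open>\<kappa>\<close> cancel. Its only possible singularities are lattice points, and
  there both functions vanish with matching first derivatives, so it extends to an entire function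
  and is constant.\<close>

lemma quasiperiodic_entire_unique:
  fixes g h :: "complex \<Rightarrow> complex" and \<kappa> :: "int \<Rightarrow> int \<Rightarrow> complex \<Rightarrow> complex"
  assumes \<tau>: "Im \<tau> > 0"
    and hol: "g holomorphic_on UNIV" "h holomorphic_on UNIV"
    and g: "\<And>l m z. g (z + of_int l * \<tau> + of_int m) = \<kappa> l m z * g z"
    and h: "\<And>l m z. h (z + of_int l * \<tau> + of_int m) = \<kappa> l m z * h z"
    and \<kappa>: "\<And>l m z. \<kappa> l m z \<noteq> 0"
    and zeros: "\<And>z. g z = 0 \<Longrightarrow> \<exists>l m :: int. z = of_int l * \<tau> + of_int m"
    and at_0: "g 0 = 0" "h 0 = 0"
    and deriv: "(g has_field_derivative D) (at 0)" "(h has_field_derivative D) (at 0)" "D \<noteq> 0"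
  shows "h z = g z"
proof -
  \<comment> \<open>The value 1 at zeros of \<open>g\<close> is the removable value
    \<open>D / D\<close>.\<close>
  define K where "K = (\<lambda>z. if g z = 0 then 1 else h z / g z)"
  have g_lattice: "g z = 0 \<longleftrightarrow> (\<exists>l m :: int. z = of_int l * \<tau> + of_int m)" for z
    using zeros g[of 0] at_0 by auto
  have periodic: "K (z + of_int l * \<tau> + of_int m) = K z" for l m z
    using \<kappa> by (simp add: K_def g h)
  \<comment> \<open>\<open>g1\<close> and \<open>h1\<close> are \<open>g z / z\<close> and
    \<open>h z / z\<close> with the value at 0 filled in. Their quotient agrees with
    \<open>K\<close> near 0, where \<open>g1\<close> does not vanish.\<close>
  define g1 where "g1 = (\<lambda>z. if z = 0 then deriv g 0 else (g z - g 0) / (z - 0))"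
  define h1 where "h1 = (\<lambda>z. if z = 0 then deriv h 0 else (h z - h 0) / (z - 0))"
  have hol1: "g1 holomorphic_on UNIV" "h1 holomorphic_on UNIV"
    unfolding g1_def h1_def using hol by (intro pole_lemma; simp)+
  have D: "deriv g 0 = D" "deriv h 0 = D"
    using deriv by (auto intro: DERIV_imp_deriv)
  define U where "U = {z. g1 z \<noteq> 0}"
  have "open U"
    unfolding U_def by (intro open_Collect_neq holomorphic_on_imp_continuous_on hol1 continuous_intros)
  have K_U: "K z = h1 z / g1 z" if "z \<in> U" for z
    using that D deriv(3) at_0 by (cases "z = 0") (auto simp: U_def K_def g1_def h1_def)
  have U0: "0 \<in> U" using D deriv by (simp add: U_def g1_def)
  have "(\<lambda>z. h1 z / g1 z) holomorphic_on U"
    by (intro holomorphic_intros holomorphic_on_subset[OF hol1(1)] holomorphic_on_subset[OF hol1(2)])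
       (auto simp: U_def)
  then have "K holomorphic_on U"
    by (rule holomorphic_transform) (simp add: K_U)
  then have K_diff: "K field_differentiable at z" if "z \<in> U" for z
    using \<open>open U\<close> that holomorphic_on_imp_differentiable_at by blast
  have "K field_differentiable at z" for z
  proof (cases "g z = 0")
    case False
    then have "z \<in> U" using at_0 by (auto simp: U_def g1_def)
    then show ?thesis by (rule K_diff)
  next
    case True
    then obtain l m :: int where z: "z = of_int l * \<tau> + of_int m"
      using zeros by blast
    \<comment> \<open>Differentiability at 0 is carried to the lattice point \<open>z\<close> by
      periodicity.\<close>
    obtain K' where "(K has_field_derivative K') (at 0)"
      using K_diff[OF U0] by (auto simp: field_differentiable_def)
    then have "((\<lambda>w. K (w + (- z))) has_field_derivative K') (at z)"
      by (subst DERIV_shift[symmetric]) simp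
    moreover have "(\<lambda>w. K (w + (- z))) = K"
    proof
      fix w
      have "K w = K ((w + (- z)) + of_int l * \<tau> + of_int m)"
        by (rule arg_cong[of _ _ K]) (simp add: z)
      then show "K (w + (- z)) = K w"
        by (simp only: periodic)
    qed
    ultimately show ?thesis by (auto simp: field_differentiable_def)
  qed
  then have "K holomorphic_on UNIV"
    by (simp add: holomorphic_on_def)
  then have "K z = K 0"
    using periodic by (rule doubly_periodic_entire_constant[OF \<tau>])
  moreover have "K 0 = 1" using at_0 by (simp add: K_def)
  \<comment> \<open>At zeros of \<open>g\<close> the value of \<open>K\<close> is 1 by definition
    and says nothing about \<open>h\<close>, so these points are treated by the quasi-periodicity of
    \<open>h\<close>.\<close>
  moreover have "h z = 0" if z: "g z = 0"
  proof -
    obtain l m :: int where "z = of_int l * \<tau> + of_int m" using zeros[OF z] by blast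
    then show ?thesis using h[of 0 l m] at_0 by simp
  qed
  ultimately show ?thesis by (cases "g z = 0") (auto simp: K_def)
qed

section \<open>Behaviour of \<open>theta_eta\<close> under lattice translations and the modular
  group\<close>

lemma theta_eta_quasiperiodic:
  fixes l m :: int
  assumes "Im \<tau> > 0"
  shows "theta_eta \<tau> (z + of_int l * \<tau> + of_int m)
    = (- 1) powi (l + m) * e2pi (- ((of_int l)\<^sup>2 * \<tau> + 2 * of_int l * z) / 2) * theta_eta \<tau> z"
  by (simp add: theta_eta_def theta_quasiperiodic[OF assms])

lemma denominator_nonzero:
  fixes a b c d :: int
  assumes "a * d - b * c = 1" "Im \<tau> > 0"
  shows "of_int c * \<tau> + of_int d \<noteq> (0 :: complex)"
proof
  assume *: "of_int c * \<tau> + of_int d = 0"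
  from arg_cong[OF this, of Im] assms(2) have "c = 0" by simp
  with * have "d = 0" by simp
  with \<open>c = 0\<close> assms(1) show False by simp
qed

lemma Im_moebius_pos:
  fixes a b c d :: int
  assumes det: "a * d - b * c = 1" and "Im \<tau> > 0"
  shows "Im ((of_int a * \<tau> + of_int b) / (of_int c * \<tau> + of_int d)) > 0"
proof -
  define j where "j = of_int c * \<tau> + of_int d"
  have j: "j \<noteq> 0" using denominator_nonzero[OF assms] by (simp add: j_def)
  have "Im ((of_int a * \<tau> + of_int b) / j) = of_int (a * d - b * c) * Im \<tau> / (norm j)\<^sup>2"
    by (simp add: Im_divide cmod_power2 j_def algebra_simps diff_divide_distrib add_divide_distrib)
  then show ?thesis
    using det assms(2) j unfolding j_def[symmetric] by simp
qed

text \<open>Division by \<open>j\<close> maps the lattice of \<open>\<tau>\<close> onto that of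
  \<open>\<tau>'\<close>; \<open>L\<close> and \<open>M\<close> are the coordinates of
  \<open>(l * \<tau> + m) / j\<close> in the basis \<open>\<tau>'\<close>, 1. The known quasi-period
  of \<open>theta_eta \<tau>'\<close> is then compared with the change of the Gaussian
  factor.\<close>

lemma theta_eta_modular_quasiperiodic:
  fixes a b c d l m :: int
  assumes det: "a * d - b * c = 1" and \<tau>: "Im \<tau> > 0"
  defines "j \<equiv> of_int c * \<tau> + of_int d"
  defines "\<tau>' \<equiv> (of_int a * \<tau> + of_int b) / j"
  defines "h \<equiv> (\<lambda>z. j * e2pi (- of_int c * z\<^sup>2 / (2 * j)) * theta_eta \<tau>' (z / j))"
  shows "h (z + of_int l * \<tau> + of_int m)
     = (- 1) powi (l + m) * e2pi (- ((of_int l)\<^sup>2 * \<tau> + 2 * of_int l * z) / 2) * h z"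
proof -
  have j: "j \<noteq> 0" using denominator_nonzero[OF det \<tau>] by (simp add: j_def)
  have \<tau>': "Im \<tau>' > 0" using Im_moebius_pos[OF det \<tau>] by (simp add: \<tau>'_def j_def)
  define L M where "L = l * d - m * c" and "M = m * a - l * b"
  have detc: "of_int a * of_int d - of_int b * of_int c = (1 :: complex)"
    using det by (metis of_int_1 of_int_diff of_int_mult)
  have tau'j: "\<tau>' * j = of_int a * \<tau> + of_int b" using j by (simp add: \<tau>'_def)
  have shift: "(z + of_int l * \<tau> + of_int m) / j = z / j + of_int L * \<tau>' + of_int M"
  proof -
    have "of_int L * (of_int a * \<tau> + of_int b) + of_int M * j
        = (of_int a * of_int d - of_int b * of_int c) * (of_int l * \<tau> + of_int m)"
      by (simp add: L_def M_def j_def algebra_simps)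
    then have "of_int l * \<tau> + of_int m = of_int L * (\<tau>' * j) + of_int M * j"
      by (simp add: tau'j detc)
    then have "z + of_int l * \<tau> + of_int m = (z / j + of_int L * \<tau>' + of_int M) * j"
      using j by (simp add: algebra_simps)
    then show ?thesis using j by (metis nonzero_mult_div_cancel_right)
  qed
  have parity: "(- 1) powi (L + M) * e2pi (of_int (L * M - l * m) / 2) = ((- 1) powi (l + m) :: complex)"
  proof -
    \<comment> \<open>The number \<open>u + v + u * v\<close> is even exactly if \<open>u\<close>
      and \<open>v\<close> both are, and a matrix of odd determinant preserves this property of
      pairs.\<close>
    have "even (L + M + L * M - l * m) \<longleftrightarrow> even (l + m)"
    proof -
      have "odd (a * d - b * c)" using det by simp
      then show ?thesis unfolding L_def M_def by (auto simp: even_mult_iff)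
    qed
    then show ?thesis
      unfolding e2pi_of_int_half minus_one_powi by auto
  qed
  have exponent: "e2pi (- of_int c * (z + of_int l * \<tau> + of_int m)\<^sup>2 / (2 * j)) *
      e2pi (- ((of_int L)\<^sup>2 * \<tau>' + 2 * of_int L * (z / j)) / 2)
     = e2pi (- ((of_int l)\<^sup>2 * \<tau> + 2 * of_int l * z) / 2) * e2pi (- of_int c * z\<^sup>2 / (2 * j))
       * e2pi (of_int (L * M - l * m) / 2)"
  proof -
    \<comment> \<open>In terms of \<open>w\<close>, \<open>L = l * j - c * w\<close>, and the
      determinant condition gives \<open>L * (a * \<tau> + b) = w - M * j\<close>. By these two
      relations all terms of the numerator except \<open>c * z\<^sup>2\<close> become multiples of
      \<open>j\<close>.\<close>
    define w where "w = of_int l * \<tau> + of_int m"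
    have L: "of_int L = of_int l * j - of_int c * w"
      by (simp add: L_def j_def w_def algebra_simps)
    have LM: "of_int L * (of_int a * \<tau> + of_int b) = w - of_int M * j"
    proof -
      have "of_int L * (of_int a * \<tau> + of_int b) + of_int M * j
        = (of_int a * of_int d - of_int b * of_int c) * w"
        by (simp add: L_def M_def j_def w_def algebra_simps)
      then show ?thesis by (simp add: detc algebra_simps)
    qed
    have "of_int c * w\<^sup>2 + (of_int L)\<^sup>2 * (of_int a * \<tau> + of_int b)
       = of_int c * w\<^sup>2 + of_int L * (w - of_int M * j)"
      by (simp add: power2_eq_square mult.assoc LM)
    also have "\<dots> = w * (of_int c * w + of_int L) - of_int L * of_int M * j"
      by (simp add: algebra_simps power2_eq_square)
    also have "\<dots> = w * (of_int l * j) - of_int L * of_int M * j"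
      by (simp add: L)
    finally have key: "of_int c * w\<^sup>2 + (of_int L)\<^sup>2 * (of_int a * \<tau> + of_int b)
       = w * (of_int l * j) - of_int L * of_int M * j" .
    have "of_int c * (z + w)\<^sup>2 + (of_int L)\<^sup>2 * (of_int a * \<tau> + of_int b) + 2 * of_int L * z
      = of_int c * z\<^sup>2 + 2 * z * (of_int c * w + of_int L)
        + (of_int c * w\<^sup>2 + (of_int L)\<^sup>2 * (of_int a * \<tau> + of_int b))"
      by (simp add: algebra_simps power2_eq_square)
    also have "\<dots> = of_int c * z\<^sup>2 + 2 * z * (of_int l * j) + (w * (of_int l * j) - of_int L * of_int M * j)"
      unfolding key by (simp add: L)
    finally have num: "of_int c * (z + w)\<^sup>2 + (of_int L)\<^sup>2 * (of_int a * \<tau> + of_int b) + 2 * of_int L * z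
      = of_int c * z\<^sup>2 + j * (2 * of_int l * z + of_int l * w - of_int L * of_int M)"
      by (simp add: algebra_simps)
    have "- of_int c * (z + w)\<^sup>2 / (2 * j) + - ((of_int L)\<^sup>2 * \<tau>' + 2 * of_int L * (z / j)) / 2
      = - (of_int c * (z + w)\<^sup>2 + (of_int L)\<^sup>2 * (of_int a * \<tau> + of_int b) + 2 * of_int L * z) / (2 * j)"
      using j by (simp add: \<tau>'_def field_simps)
    also have "\<dots> = - of_int c * z\<^sup>2 / (2 * j) - (2 * of_int l * z + of_int l * w - of_int L * of_int M) / 2"
      unfolding num using j by (simp add: field_simps)
    also have "\<dots> = - ((of_int l)\<^sup>2 * \<tau> + 2 * of_int l * z) / 2 + - of_int c * z\<^sup>2 / (2 * j)
       + of_int (L * M - l * m) / 2"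
      by (simp add: w_def algebra_simps power2_eq_square add_divide_distrib diff_divide_distrib)
    finally show ?thesis
      unfolding e2pi_add[symmetric] w_def by (simp add: add.assoc)
  qed
  have "h (z + of_int l * \<tau> + of_int m)
     = j * (e2pi (- of_int c * (z + of_int l * \<tau> + of_int m)\<^sup>2 / (2 * j)) *
        e2pi (- ((of_int L)\<^sup>2 * \<tau>' + 2 * of_int L * (z / j)) / 2)) * (- 1) powi (L + M) * theta_eta \<tau>' (z / j)"
    unfolding h_def shift theta_eta_quasiperiodic[OF \<tau>'] by (simp only: mult_ac)
  also have "\<dots> = ((- 1) powi (L + M) * e2pi (of_int (L * M - l * m) / 2)) *
      e2pi (- ((of_int l)\<^sup>2 * \<tau> + 2 * of_int l * z) / 2) * h z"
    unfolding exponent h_def by (simp only: mult_ac)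
  finally show ?thesis unfolding parity .
qed

theorem theta_eta_modular:
  fixes a b c d :: int
  assumes det: "a * d - b * c = 1" and \<tau>: "Im \<tau> > 0"
  shows "theta_eta ((of_int a * \<tau> + of_int b) / (of_int c * \<tau> + of_int d)) (z / (of_int c * \<tau> + of_int d))
    = e2pi (of_int c * z\<^sup>2 / (2 * (of_int c * \<tau> + of_int d))) / (of_int c * \<tau> + of_int d) * theta_eta \<tau> z"
proof -
  define j where "j = of_int c * \<tau> + of_int d"
  define \<tau>' where "\<tau>' = (of_int a * \<tau> + of_int b) / j"
  define h where "h = (\<lambda>z. j * e2pi (- of_int c * z\<^sup>2 / (2 * j)) * theta_eta \<tau>' (z / j))"
  have j: "j \<noteq> 0" using denominator_nonzero[OF det \<tau>] by (simp add: j_def)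
  have \<tau>': "Im \<tau>' > 0" using Im_moebius_pos[OF det \<tau>] by (simp add: \<tau>'_def j_def)
  have "h z = theta_eta \<tau> z"
  proof (rule quasiperiodic_entire_unique[OF \<tau>, where g = "theta_eta \<tau>" and h = h and D = "2 * of_real pi * \<i>" and
        \<kappa> = "\<lambda>l m z. (- 1) powi (l + m) * e2pi (- ((of_int l)\<^sup>2 * \<tau> + 2 * of_int l * z) / 2)"])
    have "(\<lambda>z. j * e2pi (- of_int c * z\<^sup>2 / (2 * j)) * (theta_eta \<tau>' \<circ> (\<lambda>z. z / j)) z) holomorphic_on UNIV"
      using j by (intro holomorphic_intros holomorphic_on_compose[THEN holomorphic_on_subset]
          holomorphic_on_subset[OF theta_eta_holomorphic[OF \<tau>']]) auto
    then show "h holomorphic_on UNIV" by (simp add: h_def)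
    show "h (z + of_int l * \<tau> + of_int m) =
         (- 1) powi (l + m) * e2pi (- ((of_int l)\<^sup>2 * \<tau> + 2 * of_int l * z) / 2) * h z" for l m z
      unfolding h_def \<tau>'_def j_def by (rule theta_eta_modular_quasiperiodic[OF det \<tau>])
    show "\<exists>l m :: int. z = of_int l * \<tau> + of_int m" if "theta_eta \<tau> z = 0" for z
      using that \<tau> eta_nonzero[OF \<tau>] by (intro theta_eq_0D) (auto simp: theta_eta_def)
    \<comment> \<open>At 0 the Gaussian factor has value 1 and derivative 0, and the factor
      \<open>j\<close> compensates the inner derivative \<open>1 / j\<close>; this is the source of
      the weight -1.\<close>
    have outer: "(theta_eta \<tau>' has_field_derivative 2 * of_real pi * \<i>) (at (0 / j))"
      using theta_eta_deriv_0[OF \<tau>'] by simp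
    have inner: "((\<lambda>z. z / j) has_field_derivative 1 / j) (at 0)"
      using j by (auto intro!: derivative_eq_intros)
    have "((\<lambda>z. theta_eta \<tau>' (z / j)) has_field_derivative 2 * of_real pi * \<i> * (1 / j)) (at 0)"
      by (rule DERIV_chain2[where g = "\<lambda>z. z / j", OF outer inner])
    moreover have "((\<lambda>z. j * e2pi (- of_int c * z\<^sup>2 / (2 * j))) has_field_derivative 0) (at 0)"
      using j by (auto intro!: derivative_eq_intros)
    ultimately have "(h has_field_derivative 0 * theta_eta \<tau>' (0 / j)
        + 2 * of_real pi * \<i> * (1 / j) * (j * e2pi (- of_int c * 0\<^sup>2 / (2 * j)))) (at 0)"
      unfolding h_def by (intro DERIV_mult)
    then show "(h has_field_derivative 2 * of_real pi * \<i>) (at 0)"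
      using j by simp
  qed (use \<tau> \<tau>' theta_eta_0 theta_eta_holomorphic theta_eta_deriv_0 theta_eta_quasiperiodic h_def in auto)
  then have h: "theta_eta \<tau> z = j * e2pi (- of_int c * z\<^sup>2 / (2 * j)) * theta_eta \<tau>' (z / j)"
    by (simp add: h_def)
  have "e2pi (of_int c * z\<^sup>2 / (2 * j)) * e2pi (- of_int c * z\<^sup>2 / (2 * j)) = 1"
    by (simp flip: e2pi_add)
  then have "e2pi (of_int c * z\<^sup>2 / (2 * j)) / j * theta_eta \<tau> z = theta_eta \<tau>' (z / j)"
    unfolding h using j by simp
  then show ?thesis by (simp add: \<tau>'_def j_def)
qed

section \<open>Joint holomorphy\<close>

text \<open>Differentiation in \<open>z\<close> produces a factor \<open>r\<close>, which
  \<open>\<bar>r\<bar> \<le> exp \<bar>r\<bar>\<close> absorbs; hence \<open>pi * B + 1\<close> in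
  place of \<open>pi * B\<close>.\<close>

lemma theta_term_uniform_bounds:
  assumes "\<delta> \<le> Im \<tau>" "\<bar>Im z\<bar> \<le> B"
  shows "norm (theta_term \<tau> z r) \<le> exp ((pi * B + 1) * \<bar>real_of_int r\<bar> - pi * \<delta> / 4 * (real_of_int r)\<^sup>2)" (is ?A)
    and "norm (of_real pi * \<i> * of_int r * theta_term \<tau> z r)
       \<le> pi * exp ((pi * B + 1) * \<bar>real_of_int r\<bar> - pi * \<delta> / 4 * (real_of_int r)\<^sup>2)" (is ?B)
proof -
  define E where "E = exp (pi * B * \<bar>real_of_int r\<bar> - pi * \<delta> / 4 * (real_of_int r)\<^sup>2)"
  have E: "norm (theta_term \<tau> z r) \<le> E"
    unfolding E_def by (rule norm_theta_term_le[OF assms])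
  have eq: "exp ((pi * B + 1) * \<bar>real_of_int r\<bar> - pi * \<delta> / 4 * (real_of_int r)\<^sup>2) = exp \<bar>real_of_int r\<bar> * E"
    unfolding E_def exp_add[symmetric] by (simp add: algebra_simps)
  have E0: "E \<ge> 0" by (simp add: E_def)
  have "1 * E \<le> exp \<bar>real_of_int r\<bar> * E"
    by (intro mult_right_mono E0) simp
  with E show ?A unfolding eq by linarith
  have "\<bar>real_of_int r\<bar> * norm (theta_term \<tau> z r) \<le> exp \<bar>real_of_int r\<bar> * E"
  proof (intro mult_mono E E0)
    show "\<bar>real_of_int r\<bar> \<le> exp \<bar>real_of_int r\<bar>"
      using exp_ge_add_one_self[of "\<bar>real_of_int r\<bar>"] by linarith
  qed auto
  then show ?B unfolding eq by (simp add: norm_mult mult.assoc)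
qed

lemma theta_bounds_summable:
  assumes "\<delta> > 0"
  shows "(\<lambda>r::int. exp ((pi * B + 1) * \<bar>real_of_int r\<bar> - pi * \<delta> / 4 * (real_of_int r)\<^sup>2)) summable_on UNIV"
  by (rule gaussian_summable) (use assms in simp)

lemma abs_Im_le_of_cball: "w \<in> cball z 1 \<Longrightarrow> \<bar>Im w\<bar> \<le> \<bar>Im z\<bar> + 1"
  using abs_Im_le_cmod[of "w - z"] by (auto simp: dist_norm norm_minus_commute)

definition theta_deriv :: "complex \<Rightarrow> complex \<Rightarrow> complex" where
  "theta_deriv \<tau> z = (\<Sum>\<^sub>\<infinity>r. of_real pi * \<i> * of_int r * theta_term \<tau> z r)"

lemma has_field_derivative_theta:
  assumes "Im \<tau> > 0"
  shows "(theta \<tau> has_field_derivative theta_deriv \<tau> z) (at z)"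
proof -
  define M where "M = (\<lambda>r::int. exp ((pi * (\<bar>Im z\<bar> + 1) + 1) * \<bar>real_of_int r\<bar> - pi * Im \<tau> / 4 * (real_of_int r)\<^sup>2))"
  have M: "M summable_on UNIV"
    unfolding M_def by (rule theta_bounds_summable[OF assms])
  let ?F = "finite_subsets_at_top (UNIV :: int set)"
  have lim: "uniform_limit (cball z 1) (\<lambda>X w. \<Sum>r\<in>X. theta_term \<tau> w r) (theta \<tau>) ?F"
  proof (rule Weierstrass_m_test_general'[where M = M])
    fix r :: int and w assume "w \<in> cball z 1"
    then show "norm (theta_term \<tau> w r) \<le> M r"
      unfolding M_def by (intro theta_term_uniform_bounds(1) abs_Im_le_of_cball) auto
  qed (use M theta_has_sum[OF assms] in auto)
  have d: "((\<lambda>w. \<Sum>r\<in>X. theta_term \<tau> w r) has_field_derivative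
      (\<Sum>r\<in>X. of_real pi * \<i> * of_int r * theta_term \<tau> w r)) (at w)" for X w
  proof (rule DERIV_sum)
    fix r
    show "((\<lambda>w. theta_term \<tau> w r) has_field_derivative of_real pi * \<i> * of_int r * theta_term \<tau> w r) (at w)"
      unfolding theta_term_def by (auto intro!: derivative_eq_intros)
  qed
  obtain g' where g': "\<And>w. w \<in> ball z 1 \<Longrightarrow> (theta \<tau> has_field_derivative g' w) (at w) \<and>
      ((\<lambda>X. \<Sum>r\<in>X. of_real pi * \<i> * of_int r * theta_term \<tau> w r) \<longlongrightarrow> g' w) ?F"
  proof (rule has_complex_derivative_uniform_limit[OF _ lim, where f' = "\<lambda>X w. \<Sum>r\<in>X. of_real pi * \<i> * of_int r * theta_term \<tau> w r"])
    show "\<forall>\<^sub>F X in ?F. continuous_on (cball z 1) (\<lambda>w. \<Sum>r\<in>X. theta_term \<tau> w r) \<and>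
        (\<forall>w\<in>ball z 1. ((\<lambda>w. \<Sum>r\<in>X. theta_term \<tau> w r) has_field_derivative
          (\<Sum>r\<in>X. of_real pi * \<i> * of_int r * theta_term \<tau> w r)) (at w))"
      using d by (intro always_eventually allI conjI ballI DERIV_continuous_on[OF has_field_derivative_at_within]) blast+
  qed auto
  have "(\<lambda>r. norm (of_real pi * \<i> * of_int r * theta_term \<tau> z r)) summable_on UNIV"
  proof (rule summable_on_comparison_test)
    show "(\<lambda>r. pi * M r) summable_on UNIV" by (intro summable_on_cmult_right M)
    show "norm (of_real pi * \<i> * of_int r * theta_term \<tau> z r) \<le> pi * M r" for r
      unfolding M_def by (intro theta_term_uniform_bounds(2)) auto
  qed auto
  from infsum_tendsto[OF abs_summable_summable[OF this]]
  have "((\<lambda>X. \<Sum>r\<in>X. of_real pi * \<i> * of_int r * theta_term \<tau> z r) \<longlongrightarrow> theta_deriv \<tau> z) ?F"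
    by (simp add: theta_deriv_def)
  moreover have "((\<lambda>X. \<Sum>r\<in>X. of_real pi * \<i> * of_int r * theta_term \<tau> z r) \<longlongrightarrow> g' z) ?F"
    using g'[of z] by simp
  ultimately have "g' z = theta_deriv \<tau> z"
    by (intro tendsto_unique[of ?F]) auto
  then show ?thesis using g'[of z] by simp
qed

text \<open>Joint continuity of one partial derivative is what turns separate differentiability into
  joint differentiability. It holds because the differentiated series converges uniformly on a
  neighbourhood \<open>R\<close> of the point.\<close>

lemma isCont_theta_deriv:
  assumes "Im \<tau> > 0"
  shows "isCont (\<lambda>(t, w). theta_deriv t w) (\<tau>, z)"
proof -
  define \<delta> B where "\<delta> = Im \<tau> / 2" and "B = \<bar>Im z\<bar> + 1"
  define R where "R = {p. \<delta> < Im (fst p) \<and> \<bar>Im (snd p)\<bar> < B}"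
  define M where "M = (\<lambda>r::int. exp ((pi * B + 1) * \<bar>real_of_int r\<bar> - pi * \<delta> / 4 * (real_of_int r)\<^sup>2))"
  have "open R"
    unfolding R_def by (intro open_Collect_conj open_Collect_less continuous_intros)
  have "continuous_on R (\<lambda>p. \<Sum>\<^sub>\<infinity>r. of_real pi * \<i> * of_int r * theta_term (fst p) (snd p) r)"
  proof (rule uniform_limit_theorem)
    show "uniform_limit R (\<lambda>X p. \<Sum>r\<in>X. of_real pi * \<i> * of_int r * theta_term (fst p) (snd p) r)
       (\<lambda>p. \<Sum>\<^sub>\<infinity>r. of_real pi * \<i> * of_int r * theta_term (fst p) (snd p) r) (finite_subsets_at_top UNIV)"
    proof (rule Weierstrass_m_test_general)
      show "(\<lambda>r. pi * M r) summable_on UNIV"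
        unfolding M_def using assms by (intro summable_on_cmult_right theta_bounds_summable) (simp add: \<delta>_def)
      show "norm (of_real pi * \<i> * of_int r * theta_term (fst p) (snd p) r) \<le> pi * M r" if "p \<in> R" for r p
        unfolding M_def using that by (intro theta_term_uniform_bounds(2)) (auto simp: R_def)
    qed
    show "\<forall>\<^sub>F X in finite_subsets_at_top UNIV. continuous_on R
       (\<lambda>p. \<Sum>r\<in>X. of_real pi * \<i> * of_int r * theta_term (fst p) (snd p) r)"
      unfolding theta_term_def by (intro always_eventually allI continuous_intros)
  qed auto
  moreover have "(\<tau>, z) \<in> R" using assms by (simp add: R_def \<delta>_def B_def)
  ultimately show ?thesis
    using \<open>open R\<close> by (simp add: continuous_on_eq_continuous_at theta_deriv_def case_prod_unfold)
qed

lemma theta_differentiable_modulus: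
  assumes "Im \<tau> > 0"
  shows "(\<lambda>t. theta t z) field_differentiable at \<tau>"
proof -
  define r where "r = Im \<tau> / 2"
  have r: "r > 0" using assms by (simp add: r_def)
  have Im_r: "r \<le> Im t" if "t \<in> cball \<tau> r" for t
    using abs_Im_le_cmod[of "t - \<tau>"] that by (auto simp: dist_norm norm_minus_commute r_def)
  define M where "M = (\<lambda>n::int. exp ((pi * \<bar>Im z\<bar> + 1) * \<bar>real_of_int n\<bar> - pi * r / 4 * (real_of_int n)\<^sup>2))"
  have M: "M summable_on UNIV"
    unfolding M_def by (rule theta_bounds_summable[OF r])
  have lim: "uniform_limit (cball \<tau> r) (\<lambda>X t. \<Sum>n\<in>X. theta_term t z n) (\<lambda>t. theta t z) (finite_subsets_at_top UNIV)"
  proof (rule Weierstrass_m_test_general'[where M = M])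
    fix n :: int and t assume t: "t \<in> cball \<tau> r"
    show "norm (theta_term t z n) \<le> M n"
      unfolding M_def using Im_r[OF t] by (intro theta_term_uniform_bounds(1)) auto
  next
    fix t assume t: "t \<in> cball \<tau> r"
    show "(theta_term t z has_sum theta t z) UNIV"
      using Im_r[OF t] r by (intro theta_has_sum) linarith
  qed (use M in auto)
  obtain "(\<lambda>t. theta t z) holomorphic_on ball \<tau> r"
    by (rule holomorphic_uniform_limit[OF _ lim])
       (auto simp: theta_term_def intro!: always_eventually continuous_intros holomorphic_intros)
  then show ?thesis
    using r by (simp add: holomorphic_on_imp_differentiable_at)
qed

text \<open>The condition in \<open>holomorphic_on_H_C\<close> at a single point, isolated so that
  closure properties can be stated pointwise.\<close>

definition jointly_differentiable :: "(complex \<Rightarrow> complex \<Rightarrow> complex) \<Rightarrow> complex \<Rightarrow> complex \<Rightarrow> bool" where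
  "jointly_differentiable f \<tau> z \<longleftrightarrow>
     (\<exists>A B. ((\<lambda>(t, w). f t w) has_derivative (\<lambda>(u, v). A * u + B * v)) (at (\<tau>, z)))"

lemma jointly_differentiable_theta:
  assumes "Im \<tau> > 0"
  shows "jointly_differentiable theta \<tau> z"
proof -
  define X where "X = {t. Im t > 0}"
  have X: "open X" "\<tau> \<in> X" using assms by (auto simp: X_def open_halfspace_Im_gt)
  obtain A where A: "((\<lambda>t. theta t z) has_field_derivative A) (at \<tau>)"
    using theta_differentiable_modulus[OF assms] by (auto simp: field_differentiable_def)
  have "((\<lambda>(t, w). theta t w) has_derivative
      (\<lambda>(u, v). A * u + blinfun_mult_right (theta_deriv \<tau> z) v)) (at (\<tau>, z) within X \<times> UNIV)"
  proof (rule has_derivative_partialsI)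
    show "((\<lambda>t. theta t z) has_derivative (*) A) (at \<tau> within X)"
      using A has_field_derivative_imp_has_derivative has_derivative_at_withinI by blast
    show "(theta t has_derivative blinfun_apply (blinfun_mult_right (theta_deriv t w))) (at w within UNIV)"
      if "t \<in> X" for t w
      using has_field_derivative_theta[of t w] that
      by (simp add: X_def has_field_derivative_def)
    have "isCont (\<lambda>p. blinfun_mult_right ((\<lambda>(t, w). theta_deriv t w) p)) (\<tau>, z)"
      using isCont_theta_deriv[OF assms]
      by (rule bounded_linear.isCont[OF bounded_linear_blinfun_mult_right])
    moreover have "(\<lambda>p. blinfun_mult_right ((\<lambda>(t, w). theta_deriv t w) p))
        = (\<lambda>(t, w). blinfun_mult_right (theta_deriv t w))"
      by (simp only: fun_eq_iff split_paired_All prod.case simp_thms)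
    ultimately have "isCont (\<lambda>(t, w). blinfun_mult_right (theta_deriv t w)) (\<tau>, z)"
      by (simp only:)
    then show "continuous (at (\<tau>, z) within X \<times> UNIV) (\<lambda>(t, w). blinfun_mult_right (theta_deriv t w))"
      by (rule continuous_at_imp_continuous_at_within)
  qed auto
  moreover have "at (\<tau>, z) within X \<times> UNIV = at (\<tau>, z)"
    using X by (intro at_within_open open_Times) auto
  ultimately show ?thesis
    unfolding jointly_differentiable_def by auto
qed

section \<open>Closure properties of joint differentiability\<close>

lemma jointly_differentiable_mult:
  assumes "jointly_differentiable f \<tau> z" "jointly_differentiable g \<tau> z"
  shows "jointly_differentiable (\<lambda>t w. f t w * g t w) \<tau> z"
proof -
  obtain A B where f: "((\<lambda>(t, w). f t w) has_derivative (\<lambda>(u, v). A * u + B * v)) (at (\<tau>, z))"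
    using assms(1) by (auto simp: jointly_differentiable_def)
  obtain A' B' where g: "((\<lambda>(t, w). g t w) has_derivative (\<lambda>(u, v). A' * u + B' * v)) (at (\<tau>, z))"
    using assms(2) by (auto simp: jointly_differentiable_def)
  have "((\<lambda>p. (case p of (t, w) \<Rightarrow> f t w) * (case p of (t, w) \<Rightarrow> g t w)) has_derivative
     (\<lambda>p. (case (\<tau>, z) of (t, w) \<Rightarrow> f t w) * (case p of (u, v) \<Rightarrow> A' * u + B' * v)
        + (case p of (u, v) \<Rightarrow> A * u + B * v) * (case (\<tau>, z) of (t, w) \<Rightarrow> g t w))) (at (\<tau>, z))"
    by (rule has_derivative_mult[OF f g])
  then show ?thesis
    unfolding jointly_differentiable_def
    by (intro exI[of _ "f \<tau> z * A' + A * g \<tau> z"] exI[of _ "f \<tau> z * B' + B * g \<tau> z"])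
       (simp add: case_prod_unfold algebra_simps)
qed

lemma jointly_differentiable_fst:
  assumes "f field_differentiable at \<tau>"
  shows "jointly_differentiable (\<lambda>t w. f t) \<tau> z"
proof -
  obtain A where "(f has_field_derivative A) (at \<tau>)"
    using assms by (auto simp: field_differentiable_def)
  then have "(f has_derivative (*) A) (at (fst (\<tau>, z)))"
    by (simp add: has_field_derivative_def)
  from has_derivative_compose[OF has_derivative_fst[OF has_derivative_ident] this]
  have "((\<lambda>p. f (fst p)) has_derivative (\<lambda>p. A * fst p)) (at (\<tau>, z))" .
  then show ?thesis
    unfolding jointly_differentiable_def
    by (intro exI[of _ A] exI[of _ 0]) (simp add: case_prod_unfold)
qed

lemma jointly_differentiable_scale:
  assumes "jointly_differentiable f \<tau> (c * z)"
  shows "jointly_differentiable (\<lambda>t w. f t (c * w)) \<tau> z"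
proof -
  obtain A B where f: "((\<lambda>(t, w). f t w) has_derivative (\<lambda>(u, v). A * u + B * v)) (at (\<tau>, c * z))"
    using assms by (auto simp: jointly_differentiable_def)
  have "((\<lambda>p. (fst p, c * snd p)) has_derivative (\<lambda>p. (fst p, c * snd p))) (at (\<tau>, z))"
    by (auto intro!: derivative_eq_intros)
  from has_derivative_compose[OF this, of "\<lambda>(t, w). f t w" "\<lambda>(u, v). A * u + B * v"] f
  have "((\<lambda>p. f (fst p) (c * snd p)) has_derivative (\<lambda>p. A * fst p + B * (c * snd p))) (at (\<tau>, z))"
    by simp
  then show ?thesis
    unfolding jointly_differentiable_def
    by (intro exI[of _ A] exI[of _ "B * c"]) (simp add: case_prod_unfold mult.assoc)
qed

section \<open>Fourier expansions\<close>

lemma has_sum_mult_Times: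
  fixes f :: "'a \<Rightarrow> complex" and g :: "'b \<Rightarrow> complex"
  assumes f: "(f has_sum x) A" and g: "(g has_sum y) B"
  shows "((\<lambda>(i, j). f i * g j) has_sum x * y) (A \<times> B)"
proof (rule has_sum_SigmaI)
  have nf: "(\<lambda>i. norm (f i)) summable_on A"
    using has_sum_imp_summable[OF f] by (simp add: summable_on_iff_abs_summable_on_complex)
  have ng: "(\<lambda>j. norm (g j)) summable_on B"
    using has_sum_imp_summable[OF g] by (simp add: summable_on_iff_abs_summable_on_complex)
  show "((\<lambda>j. case (i, j) of (i, j) \<Rightarrow> f i * g j) has_sum f i * y) B" for i
    using has_sum_cmult_right[OF g] by simp
  show "((\<lambda>i. f i * y) has_sum x * y) A"
    by (rule has_sum_cmult_left[OF f])
  have "(\<lambda>p. norm (f (fst p)) * norm (g (snd p))) summable_on A \<times> B"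
  proof (rule summable_on_SigmaI)
    show "((\<lambda>j. norm (f (fst (i, j))) * norm (g (snd (i, j)))) has_sum
        norm (f i) * infsum (\<lambda>j. norm (g j)) B) B" for i
      using has_sum_cmult_right[OF has_sum_infsum[OF ng]] by simp
    show "(\<lambda>i. norm (f i) * infsum (\<lambda>j. norm (g j)) B) summable_on A"
      by (rule summable_on_cmult_left[OF nf])
  qed auto
  then have "(\<lambda>p. norm (case p of (i, j) \<Rightarrow> f i * g j)) summable_on A \<times> B"
    by (simp add: case_prod_unfold norm_mult)
  then show "(\<lambda>(i, j). f i * g j) summable_on A \<times> B"
    by (rule abs_summable_summable)
qed

text \<open>The Euler product has no zeros in the unit disc, so the inverse of its power is
  holomorphic there and \<open>p\<close> is the sequence of its Taylor coefficients.\<close>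

lemma inverse_euler_product_expansion:
  obtains p where "p 0 = 1"
    "\<And>q. norm q < 1 \<Longrightarrow> ((\<lambda>n. p n * q ^ n) has_sum 1 / euler_product q ^ k) UNIV"
proof -
  define f where "f = (\<lambda>q. 1 / euler_product q ^ k)"
  have f: "f holomorphic_on ball 0 1"
    unfolding f_def by (intro holomorphic_intros holomorphic_euler_product) (auto simp: euler_product_nonzero)
  define p where "p = (\<lambda>n. (deriv ^^ n) f 0 / fact n)"
  have sums: "(\<lambda>n. p n * q ^ n) sums f q" if "norm q < 1" for q
    using holomorphic_power_series[OF f, of q] that by (simp add: p_def)
  show ?thesis
  proof (rule that)
    show "p 0 = 1" by (simp add: p_def f_def euler_product_0)
    fix q :: complex assume q: "norm q < 1"
    \<comment> \<open>Convergence at the larger radius \<open>x\<close> gives absolute convergence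
      at \<open>q\<close>, as an unordered sum requires.\<close>
    obtain x where x: "norm q < x" "x < 1" using dense[OF q] by blast
    have "norm (of_real x :: complex) < 1" "norm q < norm (of_real x :: complex)"
      using x order_le_less_trans[OF norm_ge_zero x(1)] by auto
    then have "summable (\<lambda>n. norm (p n * q ^ n))"
      using powser_insidea[OF sums_summable[OF sums]] by blast
    then show "((\<lambda>n. p n * q ^ n) has_sum 1 / euler_product q ^ k) UNIV"
      using sums[OF q] unfolding f_def by (rule norm_summable_imp_has_sum)
  qed
qed

section \<open>The product of three theta series over a power of eta as one sum\<close>

definition theta_index :: "(int \<times> int \<times> int \<times> nat) set" where
  "theta_index = {(r, s, t, n). odd r \<and> odd s \<and> odd t}"

definition theta_sign :: "int \<times> int \<times> int \<times> nat \<Rightarrow> int" where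
  "theta_sign = (\<lambda>(r, s, t, n). kronecker_minus4 r * kronecker_minus4 s * kronecker_minus4 t)"

text \<open>Here \<open>k\<close> is the power of eta in the denominator: \<open>k = 1\<close>
  belongs to the theta quotient itself, \<open>k = 9\<close> to its product with
  \<open>eta_power (- 8)\<close>. The entry \<open>n\<close> comes from the expansion of the inverse
  Euler product.\<close>

definition q_exponent :: "nat \<Rightarrow> int \<times> int \<times> int \<times> nat \<Rightarrow> rat" where
  "q_exponent k = (\<lambda>(r, s, t, n). of_int (r\<^sup>2 + s\<^sup>2 + t\<^sup>2) / 8 - of_nat k / 24 + of_nat n)"

definition zeta_exponent :: "nat \<Rightarrow> nat \<Rightarrow> int \<times> int \<times> int \<times> nat \<Rightarrow> rat" where
  "zeta_exponent a b = (\<lambda>(r, s, t, n). of_int (int a * r + int b * s + int (a + b) * t) / 2)"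

lemma theta_product_expansion:
  obtains p where "p 0 = 1"
    "\<And>\<tau> z. Im \<tau> > 0 \<Longrightarrow>
      ((\<lambda>i. of_int (theta_sign i) * p (snd (snd (snd i)))
         * e2pi (of_rat (q_exponent k i) * \<tau>) * e2pi (of_rat (zeta_exponent a b i) * z))
       has_sum theta_mult a \<tau> z * theta_mult b \<tau> z * theta_mult (a + b) \<tau> z / eta \<tau> ^ k) theta_index"
proof -
  obtain p where p: "p 0 = 1"
    "\<And>q. norm q < 1 \<Longrightarrow> ((\<lambda>n. p n * q ^ n) has_sum 1 / euler_product q ^ k) UNIV"
    using inverse_euler_product_expansion[where k = k] by blast
  show ?thesis
  proof (rule that[of p, OF p(1)])
    fix \<tau> z :: complex assume \<tau>: "Im \<tau> > 0"
    define q where "q = e2pi \<tau>"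
    have q: "norm q < 1" using norm_e2pi_less_1[OF \<tau>] by (simp add: q_def)
    let ?th = "\<lambda>c. theta_term \<tau> (of_nat c * z)"
    have I: "theta_index = {r. odd r} \<times> {r. odd r} \<times> {r. odd r} \<times> UNIV"
      by (auto simp: theta_index_def)
    have "((\<lambda>(r, s, t, n). ?th a r * (?th b s * (?th (a + b) t * (p n * q ^ n)))) has_sum
       theta_mult a \<tau> z * (theta_mult b \<tau> z * (theta_mult (a + b) \<tau> z * (1 / euler_product q ^ k))))
      theta_index"
      unfolding I theta_mult_def
      using has_sum_mult_Times[OF theta_has_sum_odd[OF \<tau>] has_sum_mult_Times[OF theta_has_sum_odd[OF \<tau>]
          has_sum_mult_Times[OF theta_has_sum_odd[OF \<tau>] p(2)[OF q]]]]
      by (simp add: case_prod_unfold)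
    then have "((\<lambda>i. inverse (e2pi (of_nat k * (\<tau> / 24))) *
         (case i of (r, s, t, n) \<Rightarrow> ?th a r * (?th b s * (?th (a + b) t * (p n * q ^ n))))) has_sum
       inverse (e2pi (of_nat k * (\<tau> / 24))) *
         (theta_mult a \<tau> z * (theta_mult b \<tau> z * (theta_mult (a + b) \<tau> z * (1 / euler_product q ^ k)))))
      theta_index"
      by (rule has_sum_cmult_right)
    moreover have "inverse (e2pi (of_nat k * (\<tau> / 24))) *
         (theta_mult a \<tau> z * (theta_mult b \<tau> z * (theta_mult (a + b) \<tau> z * (1 / euler_product q ^ k))))
       = theta_mult a \<tau> z * theta_mult b \<tau> z * theta_mult (a + b) \<tau> z / eta \<tau> ^ k"
      unfolding eta_conv_euler_product q_def e2pi_of_nat_mult by (simp add: power_mult_distrib field_simps)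
    moreover have "inverse (e2pi (of_nat k * (\<tau> / 24))) *
         (case i of (r, s, t, n) \<Rightarrow> ?th a r * (?th b s * (?th (a + b) t * (p n * q ^ n))))
       = of_int (theta_sign i) * p (snd (snd (snd i)))
         * e2pi (of_rat (q_exponent k i) * \<tau>) * e2pi (of_rat (zeta_exponent a b i) * z)" for i
    proof (cases i)
      case (fields r s t n)
      have "e2pi (of_rat (q_exponent k i) * \<tau>) * e2pi (of_rat (zeta_exponent a b i) * z)
        = inverse (e2pi (of_nat k * (\<tau> / 24))) * q ^ n
          * (e2pi (of_int (r\<^sup>2) / 8 * \<tau>) * e2pi (of_int r / 2 * (of_nat a * z)))
          * (e2pi (of_int (s\<^sup>2) / 8 * \<tau>) * e2pi (of_int s / 2 * (of_nat b * z)))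
          * (e2pi (of_int (t\<^sup>2) / 8 * \<tau>) * e2pi (of_int t / 2 * (of_nat (a + b) * z)))"
        unfolding q_def e2pi_of_nat_mult[symmetric] e2pi_minus[symmetric] e2pi_add[symmetric] fields
        by (rule arg_cong[of _ _ e2pi])
           (simp add: q_exponent_def zeta_exponent_def of_rat_add of_rat_diff of_rat_divide of_rat_mult
              of_rat_power field_simps)
      then show ?thesis
        unfolding fields by (simp add: theta_sign_def theta_term_def mult_ac)
    qed
    ultimately show "((\<lambda>i. of_int (theta_sign i) * p (snd (snd (snd i)))
         * e2pi (of_rat (q_exponent k i) * \<tau>) * e2pi (of_rat (zeta_exponent a b i) * z))
       has_sum theta_mult a \<tau> z * theta_mult b \<tau> z * theta_mult (a + b) \<tau> z / eta \<tau> ^ k) theta_index"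
      by simp
  qed
qed

text \<open>An unordered sum may be partitioned into fibres; on the fibre of a pair of exponents the
  exponentials are constant and factor out. Empty fibres give the coefficient 0.\<close>

lemma has_fourier_expansionI:
  fixes C :: "'i \<Rightarrow> complex" and N R :: "'i \<Rightarrow> rat"
  assumes sum: "\<And>\<tau> z. Im \<tau> > 0 \<Longrightarrow>
      ((\<lambda>i. C i * e2pi (of_rat (N i) * \<tau>) * e2pi (of_rat (R i) * z)) has_sum \<phi> \<tau> z) I"
    and exps: "\<And>i. i \<in> I \<Longrightarrow> (N i, R i) \<in> fourier_exponents s t"
  shows "has_fourier_expansion \<phi> s t (\<lambda>n r. infsum C {i \<in> I. N i = n \<and> R i = r})"
  unfolding has_fourier_expansion_def
proof (intro allI impI)
  fix \<tau> z :: complex assume \<tau>: "Im \<tau> > 0"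
  define f where "f = (\<lambda>i. C i * e2pi (of_rat (N i) * \<tau>) * e2pi (of_rat (R i) * z))"
  define X where "X = (\<lambda>x. {i \<in> I. (N i, R i) = x})"
  have f: "(f has_sum \<phi> \<tau> z) I" unfolding f_def by (rule sum[OF \<tau>])
  have "((\<lambda>p. f (snd p)) has_sum \<phi> \<tau> z) (Sigma (fourier_exponents s t) X)"
  proof (subst has_sum_reindex_bij_betw[of snd])
    show "bij_betw snd (Sigma (fourier_exponents s t) X) I"
      by (rule bij_betw_byWitness[of _ "\<lambda>i. ((N i, R i), i)"]) (use exps in \<open>auto simp: X_def\<close>)
  qed (rule f)
  moreover have "((\<lambda>i. f (snd (x, i))) has_sum
     (case x of (n, r) \<Rightarrow> infsum C {i \<in> I. N i = n \<and> R i = r} * e2pi (of_rat n * \<tau>) * e2pi (of_rat r * z))) (X x)" for x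
  proof (cases x)
    case (Pair n r)
    have "f summable_on X x"
      by (rule summable_on_subset_banach[OF has_sum_imp_summable[OF f]]) (auto simp: X_def)
    then have "(f has_sum infsum f (X x)) (X x)" by (rule has_sum_infsum)
    moreover have "infsum f (X x) = infsum (\<lambda>i. C i * (e2pi (of_rat n * \<tau>) * e2pi (of_rat r * z))) (X x)"
      by (rule infsum_cong) (auto simp: X_def f_def Pair)
    moreover have "X x = {i \<in> I. N i = n \<and> R i = r}" by (auto simp: X_def Pair)
    ultimately show ?thesis
      by (simp add: Pair infsum_cmult_left' mult.assoc)
  qed
  ultimately show "((\<lambda>(n, r). infsum C {i \<in> I. N i = n \<and> R i = r} * e2pi (of_rat n * \<tau>) * e2pi (of_rat r * z))
      has_sum \<phi> \<tau> z) (fourier_exponents s t)"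
    by (rule has_sum_Sigma')
qed

text \<open>Terms with \<open>E i > 0\<close> decay and those with \<open>E i = 0\<close> are
  constant in \<open>T\<close>. For \<open>T \<ge> 1\<close> the terms at \<open>T = 1\<close> form
  a summable majorant, because \<open>E\<close> is nonnegative wherever \<open>g\<close> does not
  vanish.\<close>

lemma has_sum_exp_limit:
  fixes g :: "'i \<Rightarrow> complex" and E :: "'i \<Rightarrow> real"
  assumes sum: "\<And>T. T > 0 \<Longrightarrow> ((\<lambda>i. g i * of_real (exp (- T * E i))) has_sum S T) I"
    and E: "\<And>i. i \<in> I \<Longrightarrow> g i \<noteq> 0 \<Longrightarrow> E i \<ge> 0"
  shows "(S \<longlongrightarrow> infsum (\<lambda>i. if E i = 0 then g i else 0) I) at_top"
proof -
  have "((\<lambda>T. infsum (\<lambda>i. g i * of_real (exp (- T * E i))) I)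
      \<longlongrightarrow> infsum (\<lambda>i. if E i = 0 then g i else 0) I) at_top"
  proof (rule infsum_dominated_convergence)
    fix i assume i: "i \<in> I"
    show "((\<lambda>T. g i * of_real (exp (- T * E i))) \<longlongrightarrow> (if E i = 0 then g i else 0)) at_top"
    proof (cases "E i = 0 \<or> g i = 0")
      case False
      then have "E i > 0" using E[OF i] by auto
      then have "((\<lambda>T. exp (- T * E i)) \<longlongrightarrow> 0) at_top"
        by real_asymp
      then have "((\<lambda>T. g i * of_real (exp (- T * E i))) \<longlongrightarrow> g i * of_real 0) at_top"
        by (intro tendsto_intros)
      then show ?thesis using False by simp
    qed auto
  next
    show "\<forall>\<^sub>F T in at_top. \<forall>i\<in>I. norm (g i * of_real (exp (- T * E i))) \<le> norm (g i * of_real (exp (- 1 * E i)))"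
    proof (rule eventually_mono[OF eventually_ge_at_top[of 1]], intro ballI)
      fix T :: real and i assume T: "1 \<le> T" and i: "i \<in> I"
      show "norm (g i * of_real (exp (- T * E i))) \<le> norm (g i * of_real (exp (- 1 * E i)))"
      proof (cases "g i = 0")
        case False
        have "1 * E i \<le> T * E i" using T E[OF i False] by (rule mult_right_mono)
        then show ?thesis by (auto simp: norm_mult intro!: mult_left_mono)
      qed auto
    qed
    show "(\<lambda>i. norm (g i * of_real (exp (- 1 * E i)))) summable_on I"
      using has_sum_imp_summable[OF sum[of 1]] by (simp add: summable_on_iff_abs_summable_on_complex)
  qed
  then show ?thesis
  proof (rule Lim_transform_eventually)
    show "\<forall>\<^sub>F T in at_top. infsum (\<lambda>i. g i * of_real (exp (- T * E i))) I = S T"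
      using eventually_gt_at_top[of 0] by eventually_elim (rule infsumI[OF sum])
  qed
qed

section \<open>Orders of vanishing\<close>

definition theta_defect :: "nat \<Rightarrow> nat \<Rightarrow> int \<times> int \<times> int \<times> nat \<Rightarrow> int" where
  "theta_defect a b = (\<lambda>(r, s, t, n).
     int a * (3 * s - (r + s - t)) - int b * (3 * r - (r + s - t)))"

definition quadratic_index :: "nat \<Rightarrow> nat \<Rightarrow> nat" where
  "quadratic_index a b = a\<^sup>2 + a * b + b\<^sup>2"

text \<open>
  By Lagrange's identity \<open>4nM - R\<^sup>2\<close> measures the distance of \<open>(r, s, t)\<close> to the line through
  \<open>(a, b, a + b)\<close>; this distance is split into the distance to the plane \<open>x + y = z\<close> and the
  distance to the line inside this plane.
\<close>

lemma discriminant_identity: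
  "12 * (4 * q_exponent 1 (r, s, t, n) * of_nat (quadratic_index a b) - (zeta_exponent a b (r, s, t, n))\<^sup>2)
   = of_int (2 * int (quadratic_index a b) * ((r + s - t)\<^sup>2 - 1) + (theta_defect a b (r, s, t, n))\<^sup>2
      + 48 * int (quadratic_index a b) * int n)"
  unfolding q_exponent_def zeta_exponent_def theta_defect_def quadratic_index_def
  by (simp add: power2_eq_square) (simp add: field_simps)

lemma odd_square_ge_1: "odd (e :: int) \<Longrightarrow> e\<^sup>2 \<ge> 1"
  by (cases "e = 0") (auto simp: int_one_le_iff_zero_less)

lemma discriminant_nonneg:
  assumes "i \<in> theta_index"
  shows "4 * q_exponent 1 i * of_nat (quadratic_index a b) - (zeta_exponent a b i)\<^sup>2 \<ge> 0"
proof (cases i)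
  case (fields r s t n)
  have cancel: "x \<ge> 0" if "12 * x \<ge> 0" for x :: rat using that by simp
  have "odd (r + s - t)" using assms by (simp add: theta_index_def fields)
  then have "(r + s - t)\<^sup>2 \<ge> 1" by (rule odd_square_ge_1)
  then have "0 \<le> 2 * int (quadratic_index a b) * ((r + s - t)\<^sup>2 - 1) + (theta_defect a b (r, s, t, n))\<^sup>2
      + 48 * int (quadratic_index a b) * int n"
    by (intro add_nonneg_nonneg mult_nonneg_nonneg) auto
  then have "0 \<le> 12 * (4 * q_exponent 1 i * of_nat (quadratic_index a b) - (zeta_exponent a b i)\<^sup>2)"
    unfolding fields discriminant_identity by (rule of_int_nonneg)
  then show ?thesis by (rule cancel)
qed

text \<open>The three summands of the discriminant identity are nonnegative, so all of them vanish;
  \<open>e\<close> is \<open>r + s - t\<close>.\<close>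

lemma discriminant_eq_0D:
  assumes i: "(r, s, t, n) \<in> theta_index" and ab: "a > 0"
    and 0: "4 * q_exponent 1 (r, s, t, n) * of_nat (quadratic_index a b) - (zeta_exponent a b (r, s, t, n))\<^sup>2 = 0"
  obtains e where "e = 1 \<or> e = - 1" "t = r + s - e" "n = 0" "int a * (3 * s - e) = int b * (3 * r - e)"
proof -
  have M: "quadratic_index a b > 0" using ab by (simp add: quadratic_index_def)
  have "odd (r + s - t)" using i by (simp add: theta_index_def)
  then have ge: "(r + s - t)\<^sup>2 \<ge> 1" by (rule odd_square_ge_1)
  have "of_int (2 * int (quadratic_index a b) * ((r + s - t)\<^sup>2 - 1) + (theta_defect a b (r, s, t, n))\<^sup>2
      + 48 * int (quadratic_index a b) * int n) = (0 :: rat)"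
    unfolding discriminant_identity[symmetric] 0 by simp
  then have "2 * int (quadratic_index a b) * ((r + s - t)\<^sup>2 - 1) + (theta_defect a b (r, s, t, n))\<^sup>2
      + 48 * int (quadratic_index a b) * int n = 0"
    by (simp only: of_int_eq_0_iff)
  moreover have "0 \<le> 2 * int (quadratic_index a b) * ((r + s - t)\<^sup>2 - 1)"
     "0 \<le> (theta_defect a b (r, s, t, n))\<^sup>2" "0 \<le> 48 * int (quadratic_index a b) * int n"
    using ge by (auto intro!: mult_nonneg_nonneg)
  ultimately have "2 * int (quadratic_index a b) * ((r + s - t)\<^sup>2 - 1) = 0"
     "(theta_defect a b (r, s, t, n))\<^sup>2 = 0" "48 * int (quadratic_index a b) * int n = 0"
    by linarith+
  then have *: "(r + s - t)\<^sup>2 = 1" "theta_defect a b (r, s, t, n) = 0" "n = 0"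
    using M by auto
  show ?thesis
  proof (rule that[of "r + s - t"])
    show "r + s - t = 1 \<or> r + s - t = - 1" using *(1) by (simp add: power2_eq_1_iff)
    show "int a * (3 * s - (r + s - t)) = int b * (3 * r - (r + s - t))"
      using *(2) by (simp add: theta_defect_def)
  qed (use * in auto)
qed

text \<open>On the line \<open>(e, e, -e)/3 + \<lambda>(a, b, a + b)\<close> the exponent of \<open>\<zeta>\<close> determines \<open>\<lambda>\<close>.\<close>

lemma line_parameter:
  fixes a b r s t e :: int
  assumes "t = r + s - e" "a * (3 * s - e) = b * (3 * r - e)"
  shows "2 * (a\<^sup>2 + a * b + b\<^sup>2) * (3 * r - e) = 3 * a * (a * r + b * s + (a + b) * t)"
    and "2 * (a\<^sup>2 + a * b + b\<^sup>2) * (3 * s - e) = 3 * b * (a * r + b * s + (a + b) * t)"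
  using assms by algebra+

text \<open>By \<open>line_parameter\<close> the exponent of zeta fixes \<open>3 * r - e\<close> and
  \<open>3 * s - e\<close>. Their residues modulo 3 determine the sign \<open>e\<close>, hence also
  \<open>r\<close>, \<open>s\<close> and \<open>t\<close>.\<close>

lemma discriminant_zero_unique:
  assumes i: "i \<in> theta_index" "i' \<in> theta_index" and ab: "a > 0" "b > 0"
    and D: "4 * q_exponent 1 i * of_nat (quadratic_index a b) - (zeta_exponent a b i)\<^sup>2 = 0"
       "4 * q_exponent 1 i' * of_nat (quadratic_index a b) - (zeta_exponent a b i')\<^sup>2 = 0"
    and zeta: "zeta_exponent a b i = zeta_exponent a b i'"
  shows "i = i'"
proof (cases i; cases i')
  fix r s t n r' s' t' n'
  assume eq: "i = (r, s, t, n)" "i' = (r', s', t', n')"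
  obtain e where e: "e = 1 \<or> e = - 1" "t = r + s - e" "n = 0" "int a * (3 * s - e) = int b * (3 * r - e)"
    using discriminant_eq_0D[OF i(1)[unfolded eq] ab(1) D(1)[unfolded eq]] by blast
  obtain e' where e': "e' = 1 \<or> e' = - 1" "t' = r' + s' - e'" "n' = 0" "int a * (3 * s' - e') = int b * (3 * r' - e')"
    using discriminant_eq_0D[OF i(2)[unfolded eq] ab(1) D(2)[unfolded eq]] by blast
  define M where "M = (int a)\<^sup>2 + int a * int b + (int b)\<^sup>2"
  have M: "M > 0" using ab by (simp add: M_def add_pos_pos)
  have "int a * r + int b * s + (int a + int b) * t = int a * r' + int b * s' + (int a + int b) * t'"
    using zeta unfolding eq zeta_exponent_def prod.case
    by (simp only: divide_cancel_right of_int_eq_iff of_nat_add zero_neq_numeral[symmetric] simp_thms)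
  then have "2 * M * (3 * r - e) = 2 * M * (3 * r' - e')" "2 * M * (3 * s - e) = 2 * M * (3 * s' - e')"
    unfolding M_def line_parameter[OF e(2,4)] line_parameter[OF e'(2,4)] by simp_all
  then have "3 * r - e = 3 * r' - e'" "3 * s - e = 3 * s' - e'" using M by auto
  then have "e = e'" "r = r'" "s = s'" using e(1) e'(1) by presburger+
  then show "i = i'" using e e' eq by simp
qed

section \<open>The congruence condition modulo 3\<close>

lemma three_dvd_product_iff:
  fixes x y :: int
  assumes "coprime x y"
  shows "3 dvd x * y * (x + y) \<longleftrightarrow> \<not> (x mod 3 = y mod 3)"
proof -
  have "\<not> (x mod 3 = 0 \<and> y mod 3 = 0)"
  proof
    assume "x mod 3 = 0 \<and> y mod 3 = 0"
    then have "3 dvd x" "3 dvd y" by auto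
    then show False using coprime_common_divisor[OF assms, of 3] by simp
  qed
  \<comment> \<open>With the residue pair (0, 0) excluded, the pairs for which 3 divides none of
    \<open>x\<close>, \<open>y\<close>, \<open>x + y\<close> are exactly (1, 1) and (2, 2).\<close>
  then have cases: "x mod 3 = 1 \<or> x mod 3 = 2 \<or> (x mod 3 = 0 \<and> y mod 3 \<noteq> 0)" by presburger
  have p: "prime (3 :: int)" by simp
  have "3 dvd x * y * (x + y) \<longleftrightarrow> 3 dvd x \<or> 3 dvd y \<or> 3 dvd x + y"
    using p by (auto simp: prime_dvd_mult_iff)
  then show ?thesis using cases by presburger
qed

text \<open>Modulo 3, \<open>k\<close> has to be the negative inverse of the common residue; 2 and 4
  are even representatives. Evenness later makes \<open>(k * x + 1) / 3\<close> odd.\<close>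

lemma even_multiplier_mod_3:
  fixes x y :: int
  assumes "x mod 3 = y mod 3" "x mod 3 \<noteq> 0"
  shows "\<exists>k. even k \<and> 3 dvd k * x + 1 \<and> 3 dvd k * y + 1"
proof (cases "x mod 3 = 1")
  case True
  then have "3 dvd 2 * x + 1" "3 dvd 2 * y + 1" using assms(1) by presburger+
  then show ?thesis by (intro exI[of _ 2]) simp
next
  case False
  then have "x mod 3 = 2" using assms(2) by presburger
  then have "3 dvd 4 * x + 1" "3 dvd 4 * y + 1" using assms(1) by presburger+
  then show ?thesis by (intro exI[of _ 4]) simp
qed

text \<open>A zero gives \<open>x * (3 * s - e) = y * (3 * r - e)\<close> with \<open>e\<close> a
  sign, hence \<open>x\<close> and \<open>y\<close> agree modulo 3; conversely a point with
  \<open>e = 1\<close> is constructed. The last component is recorded to be 0 because the term is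
  later seen to be nonzero from \<open>p 0 = 1\<close>.\<close>

lemma discriminant_zero_exists_iff:
  fixes a b :: nat
  assumes ab: "a > 0" "b > 0"
  defines "x \<equiv> a div gcd a b" and "y \<equiv> b div gcd a b"
  shows "(\<exists>i\<in>theta_index. snd (snd (snd i)) = 0 \<and>
      4 * q_exponent 1 i * of_nat (quadratic_index a b) - (zeta_exponent a b i)\<^sup>2 = 0)
     \<longleftrightarrow> \<not> 3 dvd x * y * (x + y)"
proof -
  define g where "g = gcd a b"
  have g: "g > 0" "a = g * x" "b = g * y" using ab by (simp_all add: g_def x_def y_def)
  have "coprime x y"
    unfolding x_def y_def using ab by (intro div_gcd_coprime) auto
  then have cop: "coprime (int x) (int y)" by simp
  have "3 dvd x * y * (x + y) \<longleftrightarrow> 3 dvd int x * int y * (int x + int y)"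
    by (metis of_nat_add of_nat_mult int_dvd_int_iff of_nat_numeral)
  also have "\<dots> \<longleftrightarrow> \<not> int x mod 3 = int y mod 3" by (rule three_dvd_product_iff[OF cop])
  finally have dvd: "\<not> 3 dvd x * y * (x + y) \<longleftrightarrow> int x mod 3 = int y mod 3" by blast
  show ?thesis unfolding dvd
  proof (intro iffI; (elim bexE conjE)?)
    fix i assume i: "i \<in> theta_index"
      and D: "4 * q_exponent 1 i * of_nat (quadratic_index a b) - (zeta_exponent a b i)\<^sup>2 = 0"
    obtain r s t n where eq: "i = (r, s, t, n)" by (cases i)
    obtain e where e: "e = 1 \<or> e = - 1" "int a * (3 * s - e) = int b * (3 * r - e)"
      using discriminant_eq_0D[OF i[unfolded eq] ab(1) D[unfolded eq]] by blast
    have "int g * (int x * (3 * s - e)) = int g * (int y * (3 * r - e))"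
      using e(2) unfolding g(2,3) by (simp add: mult_ac)
    then have "int x * (3 * s - e) = int y * (3 * r - e)" using g(1) by simp
    then have "int x * e - int y * e = 3 * (int x * s - int y * r)"
      by (simp add: algebra_simps)
    then have "3 dvd int x * e - int y * e" by simp
    then have "3 dvd int x - int y" using e(1) by auto presburger
    then show "int x mod 3 = int y mod 3" by (simp only: mod_eq_dvd_iff)
  next
    assume eq: "int x mod 3 = int y mod 3"
    have "\<not> (int x mod 3 = 0 \<and> int y mod 3 = 0)"
    proof
      assume "int x mod 3 = 0 \<and> int y mod 3 = 0"
      then have "3 dvd int x" "3 dvd int y" by auto
      then show False using coprime_common_divisor[OF cop, of 3] by simp
    qed
    then obtain k where k: "even k" "3 dvd k * int x + 1" "3 dvd k * int y + 1"
      using even_multiplier_mod_3[OF eq] eq by auto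
    \<comment> \<open>Then \<open>3 * r - 1\<close> and \<open>3 * s - 1\<close> are proportional to
      \<open>x\<close> and \<open>y\<close>, which makes the defect vanish for
      \<open>e = 1\<close>.\<close>
    then obtain r s where rs: "3 * r = k * int x + 1" "3 * s = k * int y + 1"
      by (metis dvdE)
    have odd: "odd r" "odd s"
      using arg_cong[OF rs(1), of even] arg_cong[OF rs(2), of even] k(1) by auto
    define t where "t = r + s - 1"
    have "12 * (4 * q_exponent 1 (r, s, t, 0) * of_nat (quadratic_index a b) - (zeta_exponent a b (r, s, t, 0))\<^sup>2) = 0"
    proof -
      have "theta_defect a b (r, s, t, 0) = int a * (3 * s - 1) - int b * (3 * r - 1)"
        by (simp add: theta_defect_def t_def)
      also have "\<dots> = 0" unfolding rs g(2,3) by simp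
      finally show ?thesis unfolding discriminant_identity by (simp add: t_def)
    qed
    moreover have "(r, s, t, 0) \<in> theta_index"
      using odd by (simp add: theta_index_def t_def)
    ultimately show "\<exists>i\<in>theta_index. snd (snd (snd i)) = 0 \<and>
      4 * q_exponent 1 i * of_nat (quadratic_index a b) - (zeta_exponent a b i)\<^sup>2 = 0"
      by (intro bexI[of _ "(r, s, t, 0)"]) (auto simp: mult_ac)
  qed
qed

text \<open>Odd squares are 1 modulo 8, so \<open>r\<^sup>2 + s\<^sup>2 + t\<^sup>2\<close> is 3
  modulo 8, and \<open>3 / 8 - 1 / 24 = 1 / 3\<close> while \<open>3 / 8 - 9 / 24 = 0\<close>. For
  odd \<open>r\<close>, \<open>s\<close>, \<open>t\<close> the doubled zeta exponent has the parity
  of \<open>2 * (a + b)\<close>.\<close>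

lemma theta_exponents:
  assumes "i \<in> theta_index"
  shows "(q_exponent 1 i, zeta_exponent a b i) \<in> fourier_exponents (1 / 3) (of_nat m)"
    and "(q_exponent 9 i, zeta_exponent a b i) \<in> fourier_exponents 0 0"
    and "q_exponent 9 i \<ge> 0"
proof -
  obtain r s t n where i: "i = (r, s, t, n)" by (cases i)
  have odd: "odd r" "odd s" "odd t" using assms by (auto simp: theta_index_def i)
  have sq: "\<exists>u. x\<^sup>2 = 8 * u + 1" if "odd x" for x :: int
  proof -
    obtain y where y: "x = 2 * y + 1" using \<open>odd x\<close> by (elim oddE)
    have "even (y * (y + 1))" by simp
    then obtain u where "y * (y + 1) = 2 * u" by (elim evenE)
    then have "x\<^sup>2 = 8 * u + 1" by (simp add: y power2_eq_square algebra_simps)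
    then show ?thesis by blast
  qed
  obtain u where u: "r\<^sup>2 + s\<^sup>2 + t\<^sup>2 = 8 * u + 3"
  proof -
    obtain u1 u2 u3 where "r\<^sup>2 = 8 * u1 + 1" "s\<^sup>2 = 8 * u2 + 1" "t\<^sup>2 = 8 * u3 + 1"
      using sq odd by metis
    then show ?thesis by (intro that[of "u1 + u2 + u3"]) simp
  qed
  have q1: "q_exponent 1 i = 1 / 3 + of_int (u + int n)"
    unfolding i q_exponent_def prod.case u by (simp add: field_simps)
  have q9: "q_exponent 9 i = of_int (u + int n)"
    unfolding i q_exponent_def prod.case u by (simp add: field_simps)
  have "u \<ge> 0"
  proof -
    have "0 \<le> r\<^sup>2 + s\<^sup>2 + t\<^sup>2" by simp
    then show ?thesis using u by linarith
  qed
  then show "q_exponent 9 i \<ge> 0" unfolding q9 by (intro of_int_nonneg) simp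
  have "even (int a * r + int b * s + int (a + b) * t)"
    using odd by simp
  then obtain v where "int a * r + int b * s + int (a + b) * t = 2 * v" by (elim evenE)
  then have z: "zeta_exponent a b i = of_int v"
    unfolding i zeta_exponent_def prod.case by simp
  show "(q_exponent 1 i, zeta_exponent a b i) \<in> fourier_exponents (1 / 3) (of_nat m)"
    unfolding fourier_exponents_def q1 z by (simp add: Ints_diff)
  show "(q_exponent 9 i, zeta_exponent a b i) \<in> fourier_exponents 0 0"
    unfolding fourier_exponents_def q9 z by (simp del: of_int_add)
qed

section \<open>Theta quotients as Jacobi forms\<close>

lemma eta_power_minus_of_nat:
  assumes "Im \<tau> > 0"
  shows "eta_power (- of_nat k) \<tau> = 1 / eta \<tau> ^ k"
proof -
  define q where "q = e2pi \<tau>"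
  have q: "norm q < 1" using norm_e2pi_less_1[OF assms] by (simp add: q_def)
  have factor: "(1 - e2pi (of_nat (Suc n) * \<tau>)) powr of_rat (- of_nat k) = inverse ((1 - q ^ Suc n) ^ k)" for n
  proof -
    have "1 - q ^ Suc n \<noteq> 0"
      using power_Suc_neq_1[OF q, of n] by (simp only: right_minus_eq not_sym)
    moreover have "of_rat (- of_nat k) = (of_int (- int k) :: complex)"
      by (simp add: of_rat_minus)
    ultimately show ?thesis
      unfolding e2pi_of_nat_mult q_def
      by (simp only: complex_powr_of_int power_int_minus power_int_of_nat simp_thms)
  qed
  have "(\<Prod>n. inverse ((1 - q ^ Suc n) ^ k)) = inverse (euler_product q ^ k)"
    unfolding euler_product_def
    by (simp only: prodinf_inverse[OF convergent_prod_power[OF convergent_prod_euler[OF q]]]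
        prodinf_power[OF convergent_prod_euler[OF q]])
  moreover have "e2pi (of_rat (- of_nat k) * \<tau> / 24) = inverse (e2pi (\<tau> / 24) ^ k)"
    by (simp add: of_rat_minus e2pi_of_nat_mult[symmetric] flip: e2pi_minus)
  ultimately show ?thesis
    unfolding eta_power_def factor eta_conv_euler_product q_def[symmetric]
    by (simp only: power_mult_distrib inverse_mult_distrib divide_inverse mult_1_left)
qed

lemma eta_field_differentiable:
  assumes "Im \<tau> > 0"
  shows "eta field_differentiable at \<tau>"
proof -
  define U where "U = {t. Im t > 0}"
  have "open U" by (simp add: U_def open_halfspace_Im_gt)
  have "(\<lambda>t. e2pi (t / 24) * (euler_product \<circ> e2pi) t) holomorphic_on U"
    by (intro holomorphic_intros holomorphic_on_compose holomorphic_on_subset[OF holomorphic_euler_product])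
       (auto simp: U_def norm_e2pi_less_1)
  then have "eta holomorphic_on U"
    by (rule holomorphic_transform) (simp add: eta_conv_euler_product)
  then show ?thesis
    using \<open>open U\<close> assms by (simp add: holomorphic_on_imp_differentiable_at U_def)
qed

lemma eta_times_theta_quotient:
  assumes "Im \<tau> > 0"
  shows "eta_power (- 8) \<tau> * theta_quotient a b \<tau> z
      = theta_mult a \<tau> z * theta_mult b \<tau> z * theta_mult (a + b) \<tau> z / eta \<tau> ^ 9"
  using eta_power_minus_of_nat[OF assms, of 8] eta_nonzero[OF assms]
  by (simp add: theta_quotient_def field_simps eval_nat_numeral)

text \<open>The ninth power of eta supplies a cube to each of the three theta functions.\<close>

lemma theta_quotient_conv_theta_eta:
  assumes "Im \<tau> > 0"
  shows "eta_power (- 8) \<tau> * theta_quotient a b \<tau> z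
      = theta_eta \<tau> (of_nat a * z) * theta_eta \<tau> (of_nat b * z) * theta_eta \<tau> (of_nat (a + b) * z)"
  unfolding eta_times_theta_quotient[OF assms] theta_eta_def theta_mult_def
  using eta_nonzero[OF assms] by (simp add: field_simps eval_nat_numeral)

lemma holomorphic_theta_quotient:
  "holomorphic_on_H_C (\<lambda>\<tau> z. eta_power (- 8) \<tau> * theta_quotient a b \<tau> z)"
  unfolding holomorphic_on_H_C_def
proof (intro allI impI)
  fix \<tau> z :: complex assume \<tau>: "Im \<tau> > 0"
  define U where "U = {t. Im t > 0}"
  have U: "open (U \<times> (UNIV :: complex set))" "(\<tau>, z) \<in> U \<times> UNIV"
    using \<tau> by (auto simp: U_def open_halfspace_Im_gt intro!: open_Times)
  have th: "jointly_differentiable (theta_mult c) \<tau> z" for c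
    unfolding theta_mult_def
    by (rule jointly_differentiable_scale[OF jointly_differentiable_theta[OF \<tau>]])
  have "(\<lambda>t. inverse (eta t ^ 9)) field_differentiable at \<tau>"
    using eta_nonzero[OF \<tau>] eta_field_differentiable[OF \<tau>]
    by (intro field_differentiable_inverse field_differentiable_power) auto
  then have "jointly_differentiable
      (\<lambda>t w. inverse (eta t ^ 9) * (theta_mult a t w * (theta_mult b t w * theta_mult (a + b) t w))) \<tau> z"
    by (intro jointly_differentiable_mult th jointly_differentiable_fst)
  then obtain A B where "((\<lambda>(t, w). inverse (eta t ^ 9)
      * (theta_mult a t w * (theta_mult b t w * theta_mult (a + b) t w))) has_derivative
      (\<lambda>(u, v). A * u + B * v)) (at (\<tau>, z))"
    unfolding jointly_differentiable_def by blast
  then have "((\<lambda>(t, w). eta_power (- 8) t * theta_quotient a b t w) has_derivative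
      (\<lambda>(u, v). A * u + B * v)) (at (\<tau>, z))"
  proof (rule has_derivative_transform_within_open[OF _ U])
    have "inverse (eta t ^ 9) * (theta_mult a t w * (theta_mult b t w * theta_mult (a + b) t w))
       = eta_power (- 8) t * theta_quotient a b t w" if "Im t > 0" for t w
      unfolding eta_times_theta_quotient[OF that] by (simp add: field_simps)
    then show "\<And>p. p \<in> U \<times> UNIV \<Longrightarrow> (case p of (t, w) \<Rightarrow> inverse (eta t ^ 9)
      * (theta_mult a t w * (theta_mult b t w * theta_mult (a + b) t w)))
      = (case p of (t, w) \<Rightarrow> eta_power (- 8) t * theta_quotient a b t w)"
      by (auto simp: U_def)
  qed
  then show "\<exists>A B. ((\<lambda>(t, w). eta_power (- 8) t * theta_quotient a b t w) has_derivative
      (\<lambda>(u, v). A * u + B * v)) (at (\<tau>, z))"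
    by blast
qed

text \<open>The three weights -1 add up to -3 and the three indices \<open>a\<^sup>2 / 2\<close>,
  \<open>b\<^sup>2 / 2\<close>, \<open>(a + b)\<^sup>2 / 2\<close> to
  \<open>quadratic_index a b\<close>.\<close>

lemma theta_quotient_modular:
  fixes c d e f :: int
  assumes det: "c * f - d * e = 1" and \<tau>: "Im \<tau> > 0"
  defines "j \<equiv> of_int e * \<tau> + of_int f"
  defines "\<tau>' \<equiv> (of_int c * \<tau> + of_int d) / j"
  shows "eta_power (- 8) \<tau>' * theta_quotient a b \<tau>' (z / j)
    = j powi (- 3) * e2pi (of_nat (quadratic_index a b) * of_int e * z\<^sup>2 / j)
       * (eta_power (- 8) \<tau> * theta_quotient a b \<tau> z)"
proof -
  have j: "j \<noteq> 0" using denominator_nonzero[OF det \<tau>] by (simp add: j_def)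
  have \<tau>': "Im \<tau>' > 0" using Im_moebius_pos[OF det \<tau>] by (simp add: \<tau>'_def j_def)
  have G: "theta_eta \<tau>' (of_nat n * (z / j))
     = e2pi (of_int e * (of_nat n * z)\<^sup>2 / (2 * j)) / j * theta_eta \<tau> (of_nat n * z)" for n
    using theta_eta_modular[OF det \<tau>, of "of_nat n * z"] by (simp add: \<tau>'_def j_def)
  have "e2pi (of_int e * (of_nat a * z)\<^sup>2 / (2 * j)) * e2pi (of_int e * (of_nat b * z)\<^sup>2 / (2 * j))
      * e2pi (of_int e * (of_nat (a + b) * z)\<^sup>2 / (2 * j))
    = e2pi (of_nat (quadratic_index a b) * of_int e * z\<^sup>2 / j)"
    unfolding e2pi_add[symmetric]
    by (rule arg_cong[of _ _ e2pi]) (use j in \<open>simp add: quadratic_index_def field_simps power2_eq_square\<close>)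
  moreover have "j powi (- 3) = 1 / j ^ 3"
    by (simp add: power_int_minus divide_inverse)
  ultimately show ?thesis
    unfolding theta_quotient_conv_theta_eta[OF \<tau>] theta_quotient_conv_theta_eta[OF \<tau>'] G
    by (simp add: power3_eq_cube) (metis (no_types, lifting) mult.assoc mult.commute)
qed

lemma mult_regroup_3:
  fixes s1 :: "'a :: comm_semiring_0"
  shows "(s1 * x1 * g1) * (s2 * x2 * g2) * (s3 * x3 * g3)
    = (s1 * s2 * s3) * (x1 * x2 * x3) * (g1 * g2 * g3)"
  by (simp only: mult_ac)

text \<open>The signs of the three factors multiply to
  \<open>(- 1) powi (2 * (a + b) * (l + m)) = 1\<close>.\<close>

lemma theta_quotient_quasiperiodic:
  fixes l m :: int
  assumes \<tau>: "Im \<tau> > 0"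
  shows "eta_power (- 8) \<tau> * theta_quotient a b \<tau> (z + of_int l * \<tau> + of_int m)
    = e2pi (- of_nat (quadratic_index a b) * ((of_int l)\<^sup>2 * \<tau> + 2 * of_int l * z))
       * (eta_power (- 8) \<tau> * theta_quotient a b \<tau> z)"
proof -
  have G: "theta_eta \<tau> (of_nat n * (z + of_int l * \<tau> + of_int m))
     = (- 1) powi (int n * (l + m)) * e2pi (- (of_nat n)\<^sup>2 * ((of_int l)\<^sup>2 * \<tau> + 2 * of_int l * z) / 2)
       * theta_eta \<tau> (of_nat n * z)" for n
  proof -
    have "of_nat n * (z + of_int l * \<tau> + of_int m)
        = of_nat n * z + of_int (int n * l) * \<tau> + of_int (int n * m)"
      by (simp add: algebra_simps)
    moreover have "- ((of_int (int n * l))\<^sup>2 * \<tau> + 2 * of_int (int n * l) * (of_nat n * z)) / 2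
        = - (of_nat n)\<^sup>2 * ((of_int l)\<^sup>2 * \<tau> + 2 * of_int l * z) / 2"
      by (simp add: power2_eq_square algebra_simps)
    moreover have "int n * l + int n * m = int n * (l + m)" by (simp add: algebra_simps)
    ultimately show ?thesis
      by (simp only: theta_eta_quasiperiodic[OF \<tau>])
  qed
  define w where "w = (of_int l)\<^sup>2 * \<tau> + 2 * of_int l * z"
  have "e2pi (- (of_nat a)\<^sup>2 * w / 2) * e2pi (- (of_nat b)\<^sup>2 * w / 2) * e2pi (- (of_nat (a + b))\<^sup>2 * w / 2)
    = e2pi (- of_nat (quadratic_index a b) * w)"
    unfolding e2pi_add[symmetric]
    by (rule arg_cong[of _ _ e2pi]) (simp add: quadratic_index_def field_simps power2_eq_square)
  moreover have "(- 1) powi (int a * (l + m)) * (- 1) powi (int b * (l + m)) * (- 1) powi (int (a + b) * (l + m))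
     = (1 :: complex)"
    unfolding minus_one_powi by auto
  ultimately show ?thesis
    unfolding theta_quotient_conv_theta_eta[OF \<tau>] G w_def[symmetric]
    by (subst mult_regroup_3) (simp only: mult_1)
qed

lemma theta_quotient_weakly_holomorphic:
  "weakly_holomorphic_jacobi_form 1 (of_nat (quadratic_index a b)) 8 (theta_quotient a b)"
proof -
  let ?F = "\<lambda>\<tau> z. eta_power (- 8) \<tau> * theta_quotient a b \<tau> z"
  obtain p where p: "\<And>\<tau> z. Im \<tau> > 0 \<Longrightarrow>
      ((\<lambda>i. of_int (theta_sign i) * p (snd (snd (snd i)))
         * e2pi (of_rat (q_exponent 9 i) * \<tau>) * e2pi (of_rat (zeta_exponent a b i) * z))
       has_sum theta_mult a \<tau> z * theta_mult b \<tau> z * theta_mult (a + b) \<tau> z / eta \<tau> ^ 9) theta_index"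
    using theta_product_expansion[where k = 9 and a = a and b = b] by blast
  define c where "c = (\<lambda>n r. infsum (\<lambda>i. of_int (theta_sign i) * p (snd (snd (snd i))))
     {i \<in> theta_index. q_exponent 9 i = n \<and> zeta_exponent a b i = r})"
  have "has_fourier_expansion ?F 0 0 c"
    unfolding c_def
    by (rule has_fourier_expansionI) (use p in \<open>auto simp: eta_times_theta_quotient theta_exponents(2)\<close>)
  moreover have "c n r = 0" if "n < 0" for n r
  proof -
    have "{i \<in> theta_index. q_exponent 9 i = n \<and> zeta_exponent a b i = r} = {}"
      using theta_exponents(3) that by force
    then show ?thesis by (simp only: c_def infsum_empty)
  qed
  ultimately have "\<exists>c. has_fourier_expansion ?F 0 0 c \<and>
      (\<exists>n0. \<forall>(n, r) \<in> fourier_exponents 0 0. n < n0 \<longrightarrow> c n r = 0)"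
    by blast
  then have "weakly_holomorphic_jacobi_form_EZ (- 3) (quadratic_index a b) ?F"
    unfolding weakly_holomorphic_jacobi_form_EZ_def
    using holomorphic_theta_quotient theta_quotient_modular theta_quotient_quasiperiodic by blast
  \<comment> \<open>The reduced weight is \<open>1 - 8 / 2 = - 3\<close>.\<close>
  then show ?thesis
    unfolding weakly_holomorphic_jacobi_form_def
    by (intro exI[of _ "- 3"] exI[of _ "quadratic_index a b"]) simp
qed

text \<open>
  Along \<open>z = x\<tau>\<close>, the factor \<open>e(mx\<^sup>2\<tau>)\<close> turns \<open>q\<^sup>n\<zeta>\<^sup>r\<close> into the power of \<open>q\<close> with exponent
  \<open>((4nm - r\<^sup>2) + (r + 2mx)\<^sup>2) / 4m\<close>.
\<close>

lemma restriction_limit: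
  fixes C :: "'i \<Rightarrow> complex" and N R :: "'i \<Rightarrow> rat" and m x :: rat
  assumes sum: "\<And>\<tau> z. Im \<tau> > 0 \<Longrightarrow>
      ((\<lambda>i. C i * e2pi (of_rat (N i) * \<tau>) * e2pi (of_rat (R i) * z)) has_sum \<phi> \<tau> z) I"
    and m: "m > 0"
    and nonneg: "\<And>i. i \<in> I \<Longrightarrow> C i \<noteq> 0 \<Longrightarrow> 4 * N i * m - (R i)\<^sup>2 \<ge> 0"
  shows "((\<lambda>T. \<phi> (\<i> * of_real T) (\<i> * of_real T * of_rat x) * of_real (exp (- T * (2 * pi * of_rat (m * x\<^sup>2)))))
    \<longlongrightarrow> infsum (\<lambda>i. if 4 * N i * m - (R i)\<^sup>2 = 0 \<and> R i = - 2 * m * x then C i else 0) I) at_top"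
proof -
  define e where "e = (\<lambda>i. N i + R i * x + m * x\<^sup>2)"
  define E where "E = (\<lambda>i. 2 * pi * of_rat (e i))"
  have e: "4 * m * e i = (4 * N i * m - (R i)\<^sup>2) + (R i + 2 * m * x)\<^sup>2" for i
    by (simp add: e_def algebra_simps power2_eq_square)
  have "((\<lambda>T. \<phi> (\<i> * of_real T) (\<i> * of_real T * of_rat x) * of_real (exp (- T * (2 * pi * of_rat (m * x\<^sup>2)))))
    \<longlongrightarrow> infsum (\<lambda>i. if E i = 0 then C i else 0) I) at_top"
  proof (rule has_sum_exp_limit)
    fix T :: real assume T: "T > 0"
    have e2pi_real: "e2pi (of_rat y * (\<i> * of_real T)) = of_real (exp (- T * (2 * pi * of_rat y)))" for y
    proof -
      have "2 * of_real pi * \<i> * (of_rat y * (\<i> * of_real T)) = of_real (- T * (2 * pi * of_rat y))"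
      proof (cases y)
        case (Fract u v)
        then show ?thesis by (simp add: of_rat_rat complex_eq_iff)
      qed
      then show ?thesis unfolding e2pi_def by (simp only: exp_of_real)
    qed
    have "((\<lambda>i. (C i * e2pi (of_rat (N i) * (\<i> * of_real T)) * e2pi (of_rat (R i) * (\<i> * of_real T * of_rat x)))
        * of_real (exp (- T * (2 * pi * of_rat (m * x\<^sup>2)))))
      has_sum \<phi> (\<i> * of_real T) (\<i> * of_real T * of_rat x) * of_real (exp (- T * (2 * pi * of_rat (m * x\<^sup>2))))) I"
      using T by (intro has_sum_cmult_left sum) simp
    moreover have "(C i * e2pi (of_rat (N i) * (\<i> * of_real T)) * e2pi (of_rat (R i) * (\<i> * of_real T * of_rat x)))
        * of_real (exp (- T * (2 * pi * of_rat (m * x\<^sup>2)))) = C i * of_real (exp (- T * E i))" for i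
    proof -
      have "e2pi (of_rat (N i) * (\<i> * of_real T)) * e2pi (of_rat (R i) * (\<i> * of_real T * of_rat x))
          * e2pi (of_rat (m * x\<^sup>2) * (\<i> * of_real T)) = e2pi (of_rat (e i) * (\<i> * of_real T))"
        unfolding e2pi_add[symmetric]
        by (rule arg_cong[of _ _ e2pi]) (simp add: e_def of_rat_add of_rat_mult algebra_simps)
      then show ?thesis
        unfolding e2pi_real[symmetric] E_def by (simp only: mult.assoc)
    qed
    ultimately show "((\<lambda>i. C i * of_real (exp (- T * E i)))
      has_sum \<phi> (\<i> * of_real T) (\<i> * of_real T * of_rat x) * of_real (exp (- T * (2 * pi * of_rat (m * x\<^sup>2))))) I"
      by (simp only:)
  next
    fix i assume "i \<in> I" "C i \<noteq> 0"
    then have "0 \<le> 4 * m * e i" unfolding e by (intro add_nonneg_nonneg nonneg) auto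
    then have "0 \<le> e i" using m by (simp add: zero_le_mult_iff)
    then show "0 \<le> E i" by (simp add: E_def)
  qed
  moreover have "infsum (\<lambda>i. if E i = 0 then C i else 0) I
      = infsum (\<lambda>i. if 4 * N i * m - (R i)\<^sup>2 = 0 \<and> R i = - 2 * m * x then C i else 0) I"
  proof (rule infsum_cong)
    fix i assume i: "i \<in> I"
    show "(if E i = 0 then C i else 0) = (if 4 * N i * m - (R i)\<^sup>2 = 0 \<and> R i = - 2 * m * x then C i else 0)"
    proof (cases "C i = 0")
      case False
      have "E i = 0 \<longleftrightarrow> 4 * m * e i = 0" using m by (simp add: E_def)
      also have "\<dots> \<longleftrightarrow> 4 * N i * m - (R i)\<^sup>2 = 0 \<and> (R i + 2 * m * x)\<^sup>2 = 0"
        unfolding e by (rule add_nonneg_eq_0_iff[OF nonneg[OF i False] zero_le_power2])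
      also have "(R i + 2 * m * x)\<^sup>2 = 0 \<longleftrightarrow> R i = - 2 * m * x"
        unfolding power_eq_0_iff by (simp add: add_eq_0_iff2)
      finally show ?thesis by (simp only:)
    qed simp
  qed
  ultimately show ?thesis by (simp only:)
qed

theorem theorem6p1:
  fixes a b :: nat
  assumes "a > 0" and "b > 0"
  shows "holomorphic_jacobi_form 1 (of_nat (a\<^sup>2 + a * b + b\<^sup>2)) 8 (theta_quotient a b)
    \<and> (jacobi_cusp_form 1 (of_nat (a\<^sup>2 + a * b + b\<^sup>2)) 8 (theta_quotient a b)
        \<longleftrightarrow> (let g = gcd a b; a' = a div g; b' = b div g in 3 dvd a' * b' * (a' + b')))"
proof -
  define M where "M = quadratic_index a b"
  have M: "M > 0" using assms by (simp add: M_def quadratic_index_def)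
  define D where "D = (\<lambda>i. 4 * q_exponent 1 i * of_nat M - (zeta_exponent a b i)\<^sup>2)"
  obtain p where p0: "p 0 = 1" and p: "\<And>\<tau> z. Im \<tau> > 0 \<Longrightarrow>
      ((\<lambda>i. of_int (theta_sign i) * p (snd (snd (snd i)))
         * e2pi (of_rat (q_exponent 1 i) * \<tau>) * e2pi (of_rat (zeta_exponent a b i) * z))
       has_sum theta_mult a \<tau> z * theta_mult b \<tau> z * theta_mult (a + b) \<tau> z / eta \<tau> ^ 1) theta_index"
    using theta_product_expansion[where k = 1 and a = a and b = b] by blast
  define C :: "int \<times> int \<times> int \<times> nat \<Rightarrow> complex" where
    "C = (\<lambda>i. of_int (theta_sign i) * p (snd (snd (snd i))))"
  have expansion: "((\<lambda>i. C i * e2pi (of_rat (q_exponent 1 i) * \<tau>) * e2pi (of_rat (zeta_exponent a b i) * z))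
       has_sum theta_quotient a b \<tau> z) theta_index" if "Im \<tau> > 0" for \<tau> z
    using p[OF that] unfolding C_def theta_quotient_def power_one_right .
  define c where "c = (\<lambda>n r. infsum C {i \<in> theta_index. q_exponent 1 i = n \<and> zeta_exponent a b i = r})"
  have c: "has_fourier_expansion (theta_quotient a b) (8 / 24) (of_nat M) c"
    unfolding c_def using theta_exponents(1)[of _ a b M]
    by (intro has_fourier_expansionI expansion) simp_all
  \<comment> \<open>Terms within a fibre may cancel, but a nonzero coefficient always has an index
    behind it. That suffices to transfer bounds on \<open>D\<close> to the exponents of the Fourier
    expansion.\<close>
  have c_nonzero: "\<exists>i\<in>theta_index. q_exponent 1 i = n \<and> zeta_exponent a b i = r" if "c n r \<noteq> 0" for n r
  proof (rule ccontr)
    assume "\<not> ?thesis"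
    then have "{i \<in> theta_index. q_exponent 1 i = n \<and> zeta_exponent a b i = r} = {}" by blast
    with that show False by (simp only: c_def infsum_empty)
  qed
  have D_nonneg: "D i \<ge> 0" if "i \<in> theta_index" for i
    using discriminant_nonneg[OF that] by (simp add: D_def M_def)
  have weak: "weakly_holomorphic_jacobi_form 1 (of_nat M) 8 (theta_quotient a b)"
    unfolding M_def by (rule theta_quotient_weakly_holomorphic)
  have "4 * n * of_nat M - r\<^sup>2 \<ge> 0" if "c n r \<noteq> 0" for n r
    using c_nonzero[OF that] D_nonneg by (auto simp: D_def)
  with c weak have hol: "holomorphic_jacobi_form 1 (of_nat M) 8 (theta_quotient a b)"
    unfolding holomorphic_jacobi_form_def by blast
  define three where "three \<longleftrightarrow> 3 dvd a div gcd a b * (b div gcd a b) * (a div gcd a b + b div gcd a b)"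
  have iff: "(\<exists>i\<in>theta_index. snd (snd (snd i)) = 0 \<and> D i = 0) \<longleftrightarrow> \<not> three"
    unfolding D_def M_def three_def by (rule discriminant_zero_exists_iff[OF assms])
  have "jacobi_cusp_form 1 (of_nat M) 8 (theta_quotient a b)" if three
  proof -
    have "D i > 0" if i: "i \<in> theta_index" for i
    proof -
      obtain r s t n where eq: "i = (r, s, t, n)" by (cases i)
      have "D i \<noteq> 0"
      proof
        assume "D i = 0"
        \<comment> \<open>The equivalence \<open>iff\<close> speaks only of indices with last
          component 0, which a vanishing discriminant forces.\<close>
        then have "n = 0"
          using discriminant_eq_0D[OF i[unfolded eq] assms(1)] unfolding D_def M_def eq by blast
        with \<open>D i = 0\<close> iff \<open>three\<close> i eq show False by auto
      qed
      with D_nonneg[OF i] show ?thesis by simp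
    qed
    then have "4 * n * of_nat M - r\<^sup>2 > 0" if "c n r \<noteq> 0" for n r
      using c_nonzero[OF that] by (auto simp: D_def)
    with c weak show ?thesis
      unfolding jacobi_cusp_form_def by blast
  qed
  moreover have three if cusp: "jacobi_cusp_form 1 (of_nat M) 8 (theta_quotient a b)"
  proof (rule ccontr)
    assume "\<not> three"
    then obtain j where j: "j \<in> theta_index" "snd (snd (snd j)) = 0" "D j = 0"
      using iff by blast
    \<comment> \<open>The cusp condition provides some expansion \<open>c'\<close>, not the
      \<open>c\<close> built above. Rather than coefficients, the limits computed from both
      expansions along one line are compared.\<close>
    obtain c' where c': "has_fourier_expansion (theta_quotient a b) (8 / 24) (of_nat M) c'"
      and pos: "\<And>n r. (n, r) \<in> fourier_exponents (8 / 24) (of_nat M) \<Longrightarrow> c' n r \<noteq> 0 \<Longrightarrow> 4 * n * of_nat M - r\<^sup>2 > 0"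
      using cusp unfolding jacobi_cusp_form_def by blast
    \<comment> \<open>On this line the square \<open>(R i + 2 * M * x)\<^sup>2\<close> vanishes
      exactly for the zeta exponent of \<open>j\<close>.\<close>
    define x where "x = - zeta_exponent a b j / (2 * of_nat M)"
    have x: "- 2 * of_nat M * x = zeta_exponent a b j" using M by (simp add: x_def)
    define S where "S = (\<lambda>T. theta_quotient a b (\<i> * of_real T) (\<i> * of_real T * of_rat x)
      * of_real (exp (- T * (2 * pi * of_rat (of_nat M * x\<^sup>2)))))"
    let ?L = "\<lambda>i. if D i = 0 \<and> zeta_exponent a b i = zeta_exponent a b j then C i else 0"
    let ?L' = "\<lambda>i. if 4 * fst i * of_nat M - (snd i)\<^sup>2 = 0 \<and> snd i = - 2 * of_nat M * x
      then c' (fst i) (snd i) else 0"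
    have "(S \<longlongrightarrow> infsum ?L theta_index) at_top"
      unfolding S_def D_def x[symmetric]
      by (rule restriction_limit[OF expansion]) (use M D_nonneg in \<open>auto simp: D_def\<close>)
    moreover have "(S \<longlongrightarrow> infsum ?L' (fourier_exponents (8 / 24) (of_nat M))) at_top"
      unfolding S_def
    proof (rule restriction_limit)
      show "((\<lambda>i. c' (fst i) (snd i) * e2pi (of_rat (fst i) * \<tau>) * e2pi (of_rat (snd i) * z))
          has_sum theta_quotient a b \<tau> z) (fourier_exponents (8 / 24) (of_nat M))" if "Im \<tau> > 0" for \<tau> z
        using c' that unfolding has_fourier_expansion_def case_prod_unfold by blast
      show "4 * fst i * of_nat M - (snd i)\<^sup>2 \<ge> 0"
        if "i \<in> fourier_exponents (8 / 24) (of_nat M)" "c' (fst i) (snd i) \<noteq> 0" for i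
        using pos[of "fst i" "snd i"] that by simp
    qed (use M in simp)
    ultimately have eq: "infsum ?L theta_index = infsum ?L' (fourier_exponents (8 / 24) (of_nat M))"
      by (rule tendsto_unique[OF trivial_limit_at_top_linorder])
    \<comment> \<open>Only discriminant 0 survives in the limit, and there \<open>c'\<close>
      vanishes by the cusp condition.\<close>
    have "infsum ?L' (fourier_exponents (8 / 24) (of_nat M)) = 0"
    proof (rule infsum_0)
      fix i :: "rat \<times> rat" assume "i \<in> fourier_exponents (8 / 24) (of_nat M)"
      then show "?L' i = 0" using pos[of "fst i" "snd i"] by force
    qed
    \<comment> \<open>By uniqueness no other index has discriminant 0 and the zeta exponent of
      \<open>j\<close>, so the limit is the single term \<open>C j\<close>, a product of three
      nonzero signs and \<open>p 0 = 1\<close>.\<close>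
    moreover have "infsum ?L theta_index = infsum ?L {j}"
    proof (rule infsum_cong_neutral)
      fix i assume i: "i \<in> theta_index - {j}"
      then show "?L i = 0"
        using discriminant_zero_unique[OF _ j(1) assms, of i] j(3) by (auto simp: D_def M_def)
    qed (use j in auto)
    ultimately have "C j = 0" using eq j(3) by simp
    moreover have "theta_sign j \<noteq> 0"
      using j(1) by (auto simp: theta_sign_def theta_index_def kronecker_minus4_nonzero)
    ultimately show False using p0 j(2) by (simp add: C_def)
  qed
  ultimately show ?thesis
    using hol unfolding M_def quadratic_index_def three_def Let_def by blast
qed

end
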